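(* Let $1\leqslant k\leqslant n-1$. Then $f:\Lambda^{k+1}\times\Lambda^{k-1}\rightarrow\mathbb{R}$ is ext-int. one affine if and only if there exist $c_s\in\Lambda^{(k+1)s}$ and $d_r\in\Lambda^{(n-k+1)r}$, for all $0\leqslant s\leqslant\left[\frac{n}{k+1}\right]$, $0\leqslant r\leqslant\left[\frac{n}{n-k+1}\right]$, such that $$f(\xi,\eta)=\sum_{s=0}^{\left[\frac{n}{k+1}\right]}\langle c_s;\xi^s\rangle+\sum_{r=0}^{\left[\frac{n}{n-k+1}\right]}\langle d_r;(\ast\eta)^r\rangle,\quad\text{for all }\xi\in\Lambda^{k+1},\ \eta\in\Lambda^{k-1}.$$
   Context: $\Lambda^k=\Lambda^k(\mathbb{R}^n)$ is the vector space of alternating $k$-linear maps on $\mathbb{R}^n$ (exterior $k$-forms), with $\Lambda^0=\mathbb{R}$ and $\Lambda^k=\{0\}$ for $k>n$; $\Lambda^1$ is identified with $\mathbb{R}^n$. The symbols $\wedge$, $\lrcorner$, $\langle\,;\rangle$, $\ast$ denote the exterior product, interior product, Euclidean scalar product and Hodge star ($\ast:\Lambda^k\to\Lambda^{n-k}$); for $a\in\Lambda^1$, $b\in\Lambda^k$, the form $a\lrcorner b\in\Lambda^{k-1}$ satisfies $\langle a\lrcorner b;c\rangle=\langle b;a\wedge c\rangle$ for all $c\in\Lambda^{k-1}$. Powers are exterior powers: $\xi^s=\xi\wedge\cdots\wedge\xi$ ($s$ times), $\xi^0=1$. $[x]$ denotes the integer part of $x$. Definition: $f:\Lambda^{k+1}\times\Lambda^{k-1}\to\mathbb{R}$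 is ext-int. one convex if for every $\xi\in\Lambda^{k+1}$, $\eta\in\Lambda^{k-1}$, $a\in\Lambda^1$, $b\in\Lambda^k$, the function $g:\mathbb{R}\to\mathbb{R}$, $g(t):=f(\xi+t\,a\wedge b,\ \eta+t\,a\lrcorner b)$, is convex. $f$ is ext-int. one affine if both $f$ and $-f$ are ext-int. one convex. *)

theory Defs
  imports "HOL-Analysis.Analysis"
begin

text \<open>
  A \<open>k\<close>-form is a real function of \<open>k\<close> vectors, encoded as a function on lists of vectors that is
  zero on lists of length other than \<open>k\<close>; this makes the encoding of a \<open>k\<close>-form unique.
  The linear order on the finite index type fixes the numbering of the standard basis, hence the
  orientation.
\<close>

type_synonym 'n form = "(real ^ 'n) list \<Rightarrow> real"

definition exterior_forms :: "nat \<Rightarrow> ('n::{finite,linorder}) form set"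
  where "exterior_forms k =
    {\<omega>. (\<forall>vs. length vs \<noteq> k \<longrightarrow> \<omega> vs = 0) \<and>
        (\<forall>vs i. length vs = k \<and> i < k \<longrightarrow> linear (\<lambda>x. \<omega> (vs[i := x]))) \<and>
        (\<forall>vs i j. length vs = k \<and> i < j \<and> j < k \<and> vs ! i = vs ! j \<longrightarrow> \<omega> vs = 0)}"

definition unit_form :: "('n::{finite,linorder}) form"
  where "unit_form vs = (if vs = [] then 1 else 0)"

text \<open>
  The normalisation \<open>1 / (k! l!)\<close> turns the sum over all permutations into the sum over shuffles,
  so that \<open>e\<^sup>1 \<and> \<dots> \<and> e\<^sup>k\<close> takes the value 1 on \<open>(e\<^sub>1, \<dots>, e\<^sub>k)\<close>.
\<close>

definition wedge :: "nat \<Rightarrow> nat \<Rightarrow> ('n::{finite,linorder}) form \<Rightarrow> 'n form \<Rightarrow> 'n form"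
  where "wedge k l \<alpha> \<beta> vs =
    (if length vs = k + l then
       (\<Sum>\<sigma> | \<sigma> permutes {..<k + l}.
          of_int (sign \<sigma>) * \<alpha> (map (\<lambda>i. vs ! \<sigma> i) [0..<k]) * \<beta> (map (\<lambda>i. vs ! \<sigma> i) [k..<k + l]))
       / (fact k * fact l)
     else 0)"

text \<open>\<open>wedge_power p \<xi> s\<close> is the \<open>s\<close>-fold exterior power of the \<open>p\<close>-form \<open>\<xi>\<close>, a \<open>p s\<close>-form.\<close>

primrec wedge_power :: "nat \<Rightarrow> ('n::{finite,linorder}) form \<Rightarrow> nat \<Rightarrow> 'n form"
  where
    "wedge_power p \<xi> 0 = unit_form"
  | "wedge_power p \<xi> (Suc s) = wedge p (p * s) \<xi> (wedge_power p \<xi> s)"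

definition basis_list :: "'n list \<Rightarrow> (real ^ ('n::{finite,linorder})) list"
  where "basis_list I = map (\<lambda>i. axis i 1) I"

definition increasing_indices :: "nat \<Rightarrow> ('n::{finite,linorder}) list set"
  where "increasing_indices k = {I. length I = k \<and> sorted_wrt (<) I}"

text \<open>
  The scalar product of \<open>k\<close>-forms for which the \<open>e\<^sup>I\<close>, \<open>I\<close> strictly increasing of length \<open>k\<close>, are
  orthonormal; the coefficient of \<open>\<alpha>\<close> at \<open>e\<^sup>I\<close> is \<open>\<alpha> (e\<^sub>I)\<close>.
\<close>

definition form_inner :: "nat \<Rightarrow> ('n::{finite,linorder}) form \<Rightarrow> 'n form \<Rightarrow> real"
  where "form_inner k \<alpha> \<beta> =
    (\<Sum>I\<in>increasing_indices k. \<alpha> (basis_list I) * \<beta> (basis_list I))"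

text \<open>The identification of 1-forms with vectors.\<close>

definition form_vector :: "'n form \<Rightarrow> real ^ ('n::{finite,linorder})"
  where "form_vector a = (\<chi> i. a [axis i 1])"

text \<open>
  Contraction in the first argument: this is the adjoint, for \<open>form_inner\<close>, of the exterior
  multiplication \<open>c \<mapsto> a \<and> c\<close> from the left.
\<close>

definition interior_product :: "('n::{finite,linorder}) form \<Rightarrow> 'n form \<Rightarrow> 'n form"
  where "interior_product a b vs = b (form_vector a # vs)"

text \<open>The form \<open>e\<^sup>1 \<and> \<dots> \<and> e\<^sup>n\<close>; \<open>card {j. j < i}\<close> is the position of the index \<open>i\<close>, from 0.\<close>

definition volume_form :: "('n::{finite,linorder}) form"
  where "volume_form vs =
    (if length vs = CARD('n) then det (\<chi> i. vs ! card {j. j < i}) else 0)"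

text \<open>
  The Hodge star of a \<open>k\<close>-form, with the convention \<open>\<alpha> \<and> \<star>\<omega> = \<langle>\<alpha>; \<omega>\<rangle> e\<^sup>1 \<and> \<dots> \<and> e\<^sup>n\<close> for
  \<open>k\<close>-forms \<open>\<alpha>\<close>. On the basis, \<open>\<star>e\<^sup>I\<close> is the sign of the permutation \<open>(I, I\<^sup>c)\<close> times
  the basis form of the complement \<open>I\<^sup>c\<close>, i.e. the form \<open>ws \<mapsto> volume_form (e\<^sub>I @ ws)\<close>.
\<close>

definition hodge_star :: "nat \<Rightarrow> ('n::{finite,linorder}) form \<Rightarrow> 'n form"
  where "hodge_star k \<omega> ws =
    (\<Sum>I\<in>increasing_indices k. \<omega> (basis_list I) * volume_form (basis_list I @ ws))"

definition ext_int_one_convex ::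
    "nat \<Rightarrow> (('n::{finite,linorder}) form \<Rightarrow> 'n form \<Rightarrow> real) \<Rightarrow> bool"
  where "ext_int_one_convex k f \<longleftrightarrow>
    (\<forall>\<xi>\<in>exterior_forms (k + 1). \<forall>\<eta>\<in>exterior_forms (k - 1).
     \<forall>a\<in>exterior_forms 1. \<forall>b\<in>exterior_forms k.
       convex_on UNIV (\<lambda>t::real. f (\<lambda>vs. \<xi> vs + t * wedge 1 k a b vs)
                                   (\<lambda>vs. \<eta> vs + t * interior_product a b vs)))"

definition ext_int_one_affine ::
    "nat \<Rightarrow> (('n::{finite,linorder}) form \<Rightarrow> 'n form \<Rightarrow> real) \<Rightarrow> bool"
  where "ext_int_one_affine k f \<longleftrightarrow>
    ext_int_one_convex k f \<and> ext_int_one_convex k (\<lambda>\<xi> \<eta>. - f \<xi> \<eta>)"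

end

theory Submission
  imports Defs "HOL-Library.Function_Algebras" "HOL-Combinatorics.Multiset_Permutations"
begin

text \<open>
  Write \<open>p = k + 1\<close> and \<open>q = n - k + 1\<close>, and pass from \<open>\<eta>\<close> to \<open>\<zeta> = \<star>\<eta>\<close>, a \<open>q\<close>-form. Since
  \<open>\<star>(a \<lrcorner> b) = \<plusminus> a \<and> \<star>b\<close> (\<open>hodge_star_interior_product\<close>), an admissible direction becomes
  \<open>(a \<and> b, \<plusminus> a \<and> \<star>b)\<close>. Because \<open>a \<and> b\<close> and \<open>a \<lrcorner> b\<close> depend on complementary components of
  \<open>b\<close> (\<open>decoupling\<close>), the admissible directions in the variables \<open>(\<xi>, \<zeta>)\<close> are all pairs
  \<open>(a \<and> \<beta>, a \<and> \<gamma>)\<close> with \<open>\<beta>\<close> and \<open>\<gamma>\<close> arbitrary. For a fixed covector \<open>a\<close> they form a linear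
  space, so an ext-int. one affine function is affine on all its translates.

  As \<open>p + q = n + 2 > n\<close>, a basis form in \<open>\<xi>\<close> and one in \<open>\<zeta>\<close> always share a factor \<open>e\<^sup>i\<close>, hence
  the function has no interaction between the two variables (\<open>separation\<close>) and splits into a
  function of \<open>\<xi>\<close> and a function of \<open>\<zeta>\<close>. Each of them is affine along the directions
  \<open>a \<and> \<beta>\<close>.

  For such a function \<open>G\<close>, the \<open>s\<close>-th mixed difference at 0 with increments
  \<open>v\<^sub>1 \<and> \<dots> \<and> v\<^sub>p, v\<^sub>p\<^sub>+\<^sub>1 \<and> \<dots>, \<dots>\<close> is linear in every \<open>v\<^sub>i\<close>, and it vanishes when two of these vectors
  agree, be it within one increment or in two: it is a \<open>p s\<close>-form \<open>C\<^sub>s\<close>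
  (\<open>mixed_difference_forms\<close>), zero if \<open>p s > n\<close>. Integrating along rays gives the finite Taylor
  expansion \<open>G \<xi> = (\<Sum>s. \<langle>C\<^sub>s; \<xi>\<^sup>s\<rangle> / s!)\<close> (\<open>taylor_expansion\<close>).

  Conversely, \<open>\<langle>c; \<xi>\<^sup>s\<rangle>\<close> is affine along \<open>a \<and> \<beta>\<close> because \<open>a \<and> \<beta>\<close> cannot occur twice in a
  product (\<open>power_pairing_affine\<close>). All algebra rests on one identity: contraction of a form with
  \<open>\<alpha> \<and> \<beta>\<close> is contraction with \<open>\<alpha>\<close> followed by contraction with \<open>\<beta>\<close> (\<open>contract_wedge\<close>). With the
  scalar product, the interior product and the Hodge star all being contractions, it replaces
  computations with exterior products by evaluations of alternating maps.
\<close>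

section \<open>Alternating forms and their coefficients\<close>

text \<open>
  Forms are added pointwise through the instances for function types; these give no scalar
  multiplication.
\<close>

definition scale_form :: "real \<Rightarrow> 'n form \<Rightarrow> 'n form" (infixr "\<cdot>" 75)
  where "t \<cdot> \<omega> = (\<lambda>vs. t * \<omega> vs)"

lemma scale_form_apply [simp]: "(t \<cdot> \<omega>) vs = t * \<omega> vs"
  by (simp add: scale_form_def)

lemma scale_form_simps [simp]: "1 \<cdot> \<omega> = \<omega>" "0 \<cdot> \<omega> = 0" "t \<cdot> 0 = 0" "s \<cdot> t \<cdot> \<omega> = (s * t) \<cdot> \<omega>"
  by (auto simp: fun_eq_iff)

lemma sum_fun_apply: "(\<Sum>i\<in>A. f i) x = (\<Sum>i\<in>A. f i x)"
  by (induction A rule: infinite_finite_induct) auto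

lemma forms_length: "\<omega> \<in> exterior_forms k \<Longrightarrow> length vs \<noteq> k \<Longrightarrow> \<omega> vs = 0"
  by (auto simp: exterior_forms_def)

lemma forms_linear:
  "\<omega> \<in> exterior_forms k \<Longrightarrow> length vs = k \<Longrightarrow> i < k \<Longrightarrow> linear (\<lambda>x. \<omega> (vs[i := x]))"
  by (auto simp: exterior_forms_def)

lemma forms_repeat:
  "\<omega> \<in> exterior_forms k \<Longrightarrow> i < length vs \<Longrightarrow> j < length vs \<Longrightarrow> i \<noteq> j \<Longrightarrow> vs ! i = vs ! j \<Longrightarrow> \<omega> vs = 0"
  by (cases "length vs = k"; cases "i < j")
    (simp_all add: exterior_forms_def nat_neq_iff, metis+)

lemma forms_not_distinct: "\<omega> \<in> exterior_forms k \<Longrightarrow> \<not> distinct vs \<Longrightarrow> \<omega> vs = 0"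
  by (auto simp: distinct_conv_nth intro: forms_repeat)

lemma forms_zero [simp]: "0 \<in> exterior_forms k"
  by (auto simp: exterior_forms_def linear_iff)

lemma forms_add [intro]:
  "\<omega> \<in> exterior_forms k \<Longrightarrow> \<omega>' \<in> exterior_forms k \<Longrightarrow> \<omega> + \<omega>' \<in> exterior_forms k"
  by (auto simp: exterior_forms_def plus_fun_def intro: linear_compose_add)

lemma forms_scale [intro]: "\<omega> \<in> exterior_forms k \<Longrightarrow> t \<cdot> \<omega> \<in> exterior_forms k"
  by (auto simp: exterior_forms_def linear_iff algebra_simps)

lemma forms_sum [intro]:
  "(\<And>i. i \<in> A \<Longrightarrow> g i \<in> exterior_forms k) \<Longrightarrow> (\<Sum>i\<in>A. g i) \<in> exterior_forms k"
  by (induction A rule: infinite_finite_induct) auto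

lemma unit_form_forms [simp]: "unit_form \<in> exterior_forms 0"
  by (auto simp: exterior_forms_def unit_form_def)

lemma permute_list_transpose:
  assumes "a < length vs" "b < length vs"
  shows "permute_list (Transposition.transpose a b) vs = vs[a := vs ! b, b := vs ! a]"
  using assms by (intro nth_equalityI) (auto simp: permute_list_def nth_list_update
    Transposition.transpose_def)

lemma forms_swap:
  assumes w: "\<omega> \<in> exterior_forms k" and ij: "i < length vs" "j < length vs" "i \<noteq> j"
  shows "\<omega> (vs[i := vs ! j, j := vs ! i]) = - \<omega> vs"
proof (cases "length vs = k")
  case True
  define x y where "x = vs ! i" and "y = vs ! j"
  let ?f = "\<lambda>u v. \<omega> (vs[i := u, j := v])"
  have l2: "linear (?f u)" for u
    using forms_linear[OF w, of "vs[i := u]" j] ij True by simp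
  have l1: "linear (\<lambda>u. ?f u v)" for v
    using forms_linear[OF w, of "vs[j := v]" i] ij True by (simp add: list_update_swap[of i j])
  have z: "?f u u = 0" for u
    using ij by (intro forms_repeat[OF w, of i _ j]) auto
  have "0 = ?f (x + y) (x + y)" by (simp add: z)
  also have "\<dots> = ?f x x + ?f x y + (?f y x + ?f y y)"
    by (simp add: linear_add[OF l1] linear_add[OF l2])
  finally have "?f y x = - ?f x y" by (simp add: z)
  then show ?thesis by (simp add: x_def y_def)
qed (use forms_length[OF w] in auto)

lemma forms_permute:
  assumes w: "\<omega> \<in> exterior_forms k" and s: "\<sigma> permutes {..<length vs}"
  shows "\<omega> (permute_list \<sigma> vs) = of_int (sign \<sigma>) * \<omega> vs"
  using finite_lessThan s
proof (induction \<sigma> rule: permutes_rev_induct)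
  case id
  then show ?case by simp
next
  case (swap a b p)
  have t: "Transposition.transpose a b permutes {..<length vs}"
    by (rule permutes_swap_id) (use swap in auto)
  have "\<omega> (permute_list (p \<circ> Transposition.transpose a b) vs)
      = - \<omega> (permute_list p vs)"
    using swap forms_swap[OF w, of a "permute_list p vs" b]
    by (simp add: permute_list_compose[OF t] permute_list_transpose)
  also have "\<dots> = of_int (sign (p \<circ> Transposition.transpose a b)) * \<omega> vs"
    using swap permutes_imp_permutation[OF _ t]
      permutes_imp_permutation[OF _ \<open>p permutes {..<length vs}\<close>]
    by (simp add: sign_compose sign_swap_id)
  finally show ?case .
qed

lemma forms_move_to_front:
  assumes w: "\<omega> \<in> exterior_forms k"
  shows "\<omega> (us @ x # ws) = (-1) ^ length us * \<omega> (x # us @ ws)"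
proof (induction us arbitrary: ws rule: rev_induct)
  case (snoc u us)
  have "\<omega> (us @ x # u # ws) = - \<omega> (us @ u # x # ws)"
    using forms_swap[OF w, of "length us" "us @ u # x # ws" "Suc (length us)"]
    by (simp add: nth_append list_update_append)
  with snoc[of "u # ws"] show ?case by simp
qed simp

text \<open>
  The sign of the permutation that exchanges two blocks is the parity of the product of their
  lengths. On the volume form this gives the sign of \<open>\<star>\<star>\<close>.
\<close>

lemma forms_move_block:
  assumes w: "\<omega> \<in> exterior_forms k"
  shows "\<omega> (us @ xs @ ws) = (-1) ^ (length us * length xs) * \<omega> (xs @ us @ ws)"
proof (induction xs arbitrary: us)
  case (Cons x xs)
  have "\<omega> (us @ (x # xs) @ ws) = (-1) ^ length us * \<omega> ((x # us) @ xs @ ws)"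
    using forms_move_to_front[OF w, of us x "xs @ ws"] by simp
  also have "\<omega> ((x # us) @ xs @ ws) = (-1) ^ (Suc (length us) * length xs) * \<omega> (xs @ x # us @ ws)"
    using Cons[of "x # us"] by simp
  also have "\<omega> (xs @ x # us @ ws) = (-1) ^ length xs * \<omega> (x # xs @ us @ ws)"
    by (rule forms_move_to_front[OF w])
  finally show ?case by (simp add: power_add algebra_simps flip: power_mult)
qed simp

lemma forms_repeated_front:
  assumes w: "\<omega> \<in> exterior_forms k" and "x \<in> set vs"
  shows "\<omega> (x # vs) = 0"
  by (rule forms_not_distinct[OF w]) (use assms in auto)

lemma forms_prefix:
  fixes \<omega> :: "'n::{finite,linorder} form"
  assumes w: "\<omega> \<in> exterior_forms (length us + k)"
  shows "(\<lambda>vs. \<omega> (us @ vs)) \<in> exterior_forms k"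
  unfolding exterior_forms_def
proof (intro CollectI conjI allI impI; (elim conjE)?)
  fix vs :: "(real, 'n) vec list" assume "length vs \<noteq> k"
  then show "\<omega> (us @ vs) = 0" by (intro forms_length[OF w]) auto
next
  fix vs :: "(real, 'n) vec list" and i assume "length vs = k" "i < k"
  then show "linear (\<lambda>x. \<omega> (us @ vs[i := x]))"
    using forms_linear[OF w, of "us @ vs" "length us + i"] by (simp add: list_update_append)
next
  fix vs :: "(real, 'n) vec list" and i j assume "length vs = k" "i < j" "j < k" "vs ! i = vs ! j"
  then show "\<omega> (us @ vs) = 0"
    by (intro forms_repeat[OF w, of "length us + i" _ "length us + j"]) auto
qed

lemma forms_Cons: "\<omega> \<in> exterior_forms (Suc k) \<Longrightarrow> (\<lambda>vs. \<omega> (x # vs)) \<in> exterior_forms k"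
  using forms_prefix[of \<omega> "[x]" k] by simp

lemma forms_suffix:
  fixes \<omega> :: "'n::{finite,linorder} form"
  assumes w: "\<omega> \<in> exterior_forms (k + length ws)"
  shows "(\<lambda>vs. \<omega> (vs @ ws)) \<in> exterior_forms k"
proof -
  have "(\<lambda>vs. \<omega> (vs @ ws)) = (-1) ^ (k * length ws) \<cdot> (\<lambda>vs. \<omega> (ws @ vs))"
  proof
    fix vs
    show "\<omega> (vs @ ws) = ((-1) ^ (k * length ws) \<cdot> (\<lambda>vs. \<omega> (ws @ vs))) vs"
      using forms_move_block[OF w, of vs ws "[]"] forms_length[OF w, of "vs @ ws"]
        forms_length[OF w, of "ws @ vs"]
      by (cases "length vs = k") auto
  qed
  moreover have "\<omega> \<in> exterior_forms (length ws + k)" using w by (simp add: add.commute)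
  ultimately show ?thesis using forms_prefix[of \<omega> ws k] by (auto intro: forms_scale)
qed

lemma basis_list_simps [simp]:
  "basis_list [] = []" "basis_list (i # I) = axis i 1 # basis_list I"
  "basis_list (I @ J) = basis_list I @ basis_list J" "length (basis_list I) = length I"
  by (auto simp: basis_list_def)

lemma basis_list_permute:
  "\<sigma> permutes {..<length L} \<Longrightarrow> basis_list (permute_list \<sigma> L) = permute_list \<sigma> (basis_list L)"
  unfolding basis_list_def by (rule permute_list_map[symmetric])

lemma forms_basis_not_distinct:
  "\<omega> \<in> exterior_forms k \<Longrightarrow> \<not> distinct L \<Longrightarrow> \<omega> (basis_list L) = 0"
  by (rule forms_not_distinct) (auto simp: basis_list_def distinct_map)

lemma forms_expand_first:
  assumes w: "\<omega> \<in> exterior_forms (Suc k)"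
  shows "\<omega> (x # ws) = (\<Sum>i\<in>UNIV. x $ i * \<omega> (axis i 1 # ws))"
proof (cases "length ws = k")
  case True
  then have l: "linear (\<lambda>x. \<omega> (x # ws))"
    using forms_linear[OF w, of "x # ws" 0] by simp
  have "\<omega> (x # ws) = \<omega> ((\<Sum>i\<in>UNIV. x $ i *\<^sub>R axis i 1) # ws)"
    using basis_expansion[of x] by (simp add: scalar_mult_eq_scaleR)
  also have "\<dots> = (\<Sum>i\<in>UNIV. x $ i * \<omega> (axis i 1 # ws))"
    by (simp add: linear_sum[OF l] linear_scale[OF l])
  finally show ?thesis .
qed (use forms_length[OF w] in auto)

lemma forms_zero_on_basis_lists:
  assumes "\<omega> \<in> exterior_forms k" "\<And>L. length L = k \<Longrightarrow> \<omega> (basis_list L) = 0"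
  shows "\<omega> vs = 0"
  using assms
proof (induction k arbitrary: \<omega> vs)
  case 0
  then show ?case using forms_length[of \<omega> 0 vs] "0.prems"(2)[of "[]"] by (cases vs) auto
next
  case (Suc k)
  show ?case
  proof (cases vs)
    case Nil
    then show ?thesis using forms_length[OF Suc.prems(1)] by simp
  next
    case (Cons x ws)
    have "\<omega> (axis i 1 # ws) = 0" for i
    proof (rule Suc.IH[OF forms_Cons[OF Suc.prems(1)]])
      fix L :: "'a list" assume "length L = k"
      then show "\<omega> (axis i 1 # basis_list L) = 0" using Suc.prems(2)[of "i # L"] by simp
    qed
    then show ?thesis by (simp add: Cons forms_expand_first[OF Suc.prems(1), of x ws])
  qed
qed

lemma finite_increasing [simp]: "finite (increasing_indices k :: 'n::{finite,linorder} list set)"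
  by (rule finite_subset[OF _ finite_lists_length_eq[of UNIV k]]) (auto simp: increasing_indices_def)

lemma finite_lists_of_length [simp]: "finite {L :: 'n::finite list. length L = k}"
  using finite_lists_length_eq[of "UNIV :: 'n set" k] by simp

lemma increasing_length: "I \<in> increasing_indices k \<Longrightarrow> length I = k"
  by (simp add: increasing_indices_def)

lemma increasing_distinct: "I \<in> increasing_indices k \<Longrightarrow> distinct I"
  by (simp add: increasing_indices_def strict_sorted_iff)

lemma sorted_list_increasing:
  "finite A \<Longrightarrow> sorted_list_of_set A \<in> increasing_indices (card A)"
  by (simp add: increasing_indices_def)

text \<open>
  Multilinearity reduces the claim to lists of basis vectors, and alternation reduces these to
  increasing lists. This is the nondegeneracy behind every identity of forms below.
\<close>

lemma forms_zero_if_coefficients_zero: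
  assumes w: "\<omega> \<in> exterior_forms k" and z: "\<And>I. I \<in> increasing_indices k \<Longrightarrow> \<omega> (basis_list I) = 0"
  shows "\<omega> vs = 0"
proof (rule forms_zero_on_basis_lists[OF w])
  fix L :: "'a list" assume L: "length L = k"
  show "\<omega> (basis_list L) = 0"
  proof (cases "distinct L")
    case True
    let ?K = "sorted_list_of_set (set L)"
    have K: "?K \<in> increasing_indices k"
      using sorted_list_increasing[of "set L"] True L by (simp add: distinct_card)
    have "mset L = mset ?K" using True
      by (metis List.finite_set distinct_sorted_list_of_set set_eq_iff_mset_eq_distinct
        sorted_list_of_set.set_sorted_key_list_of_set)
    then obtain p where p: "p permutes {..<length ?K}" "permute_list p ?K = L"
      by (rule mset_eq_permutation)
    have "\<omega> (basis_list L) = of_int (sign p) * \<omega> (basis_list ?K)"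
      using forms_permute[OF w, of p "basis_list ?K"] p basis_list_permute[OF p(1)] by simp
    then show ?thesis by (simp add: z[OF K])
  qed (rule forms_basis_not_distinct[OF w])
qed

lemma forms_eqI:
  assumes "\<omega> \<in> exterior_forms k" "\<omega>' \<in> exterior_forms k"
    and "\<And>I. I \<in> increasing_indices k \<Longrightarrow> \<omega> (basis_list I) = \<omega>' (basis_list I)"
  shows "\<omega> = \<omega>'"
proof
  fix vs
  have "\<omega> + (-1) \<cdot> \<omega>' \<in> exterior_forms k" using assms by blast
  from forms_zero_if_coefficients_zero[OF this, of vs] assms(3) show "\<omega> vs = \<omega>' vs" by simp
qed

lemma forms_high_degree_zero:
  assumes w: "\<omega> \<in> exterior_forms k" and "k > CARD('n)"
  shows "\<omega> = (0 :: 'n::{finite,linorder} form)"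
proof (rule forms_eqI[OF w forms_zero])
  fix I :: "'n list" assume I: "I \<in> increasing_indices k"
  then have "k = card (set I)" by (simp add: increasing_length increasing_distinct distinct_card)
  then show "\<omega> (basis_list I) = 0 (basis_list I)" 
    using assms(2) card_mono[of "UNIV :: 'n set" "set I"] by simp
qed

section \<open>Contraction as the adjoint of the exterior product\<close>

text \<open>
  A set of \<open>m\<close> indices has \<open>m!\<close> enumerations. Sums over increasing lists are awkward under
  concatenation and permutation; sums over all lists are not, and this lemma is the passage
  between the two.
\<close>

lemma sum_over_lists_eq_sum_over_increasing:
  fixes \<phi> :: "'n::{finite,linorder} list \<Rightarrow> real"
  assumes nd: "\<And>L. length L = m \<Longrightarrow> \<not> distinct L \<Longrightarrow> \<phi> L = 0"
    and sym: "\<And>L L'. length L = m \<Longrightarrow> mset L = mset L' \<Longrightarrow> \<phi> L = \<phi> L'"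
  shows "(\<Sum>L | length L = m. \<phi> L) = fact m * (\<Sum>K\<in>increasing_indices m. \<phi> K)"
proof -
  let ?A = "{A :: 'n set. card A = m}"
  have "(\<Sum>L | length L = m. \<phi> L) = (\<Sum>L | length L = m \<and> distinct L. \<phi> L)"
    by (rule sum.mono_neutral_right) (auto simp: nd)
  also have "{L :: 'n list. length L = m \<and> distinct L} = (\<Union>A\<in>?A. permutations_of_set A)"
    by (auto simp: permutations_of_set_def distinct_card)
  also have "(\<Sum>L\<in>\<dots>. \<phi> L) = (\<Sum>A\<in>?A. \<Sum>L\<in>permutations_of_set A. \<phi> L)"
    by (rule sum.UNION_disjoint) (auto simp: permutations_of_set_def
      finite_permutations_of_set[unfolded permutations_of_set_def])
  also have "\<dots> = (\<Sum>A\<in>?A. fact m * \<phi> (sorted_list_of_set A))"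
  proof (rule sum.cong[OF refl])
    fix A :: "'n set" assume "A \<in> ?A"
    then have "\<phi> L = \<phi> (sorted_list_of_set A)" if "L \<in> permutations_of_set A" for L
      using that by (intro sym)
       (auto simp: permutations_of_set_def distinct_card set_eq_iff_mset_eq_distinct[symmetric])
    then show "(\<Sum>L\<in>permutations_of_set A. \<phi> L) = fact m * \<phi> (sorted_list_of_set A)"
      using \<open>A \<in> ?A\<close> by simp
  qed
  also have "\<dots> = fact m * (\<Sum>A\<in>?A. \<phi> (sorted_list_of_set A))"
    by (simp add: sum_distrib_left)
  also have "(\<Sum>A\<in>?A. \<phi> (sorted_list_of_set A)) = (\<Sum>K\<in>increasing_indices m. \<phi> K)"
    by (rule sum.reindex_bij_witness[of _ set sorted_list_of_set])
       (auto simp: increasing_indices_def strict_sorted_iff distinct_card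
         sorted_list_of_set.idem_if_sorted_distinct)
  finally show ?thesis .
qed

text \<open>
  Contraction of \<open>c\<close> with \<open>\<alpha>\<close> in its first \<open>k\<close> arguments. The scalar product, the interior
  product with a covector and the Hodge star are all instances: for \<open>c\<close> of the same degree
  (evaluated at the empty list), \<open>\<alpha>\<close> of degree one, and \<open>c\<close> the volume form, respectively.
\<close>

definition contract :: "nat \<Rightarrow> ('n::{finite,linorder}) form \<Rightarrow> 'n form \<Rightarrow> 'n form"
  where "contract k c \<alpha> ws = (\<Sum>I\<in>increasing_indices k. \<alpha> (basis_list I) * c (basis_list I @ ws))"

lemma form_inner_eq_contract: "form_inner k c \<alpha> = contract k c \<alpha> []"
  by (simp add: form_inner_def contract_def mult.commute)

lemma hodge_star_eq_contract: "hodge_star k = contract k volume_form"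
  by (simp add: fun_eq_iff hodge_star_def contract_def)

lemma contract_linear:
  "contract k (c + c') \<alpha> = contract k c \<alpha> + contract k c' \<alpha>"
  "contract k (t \<cdot> c) \<alpha> = t \<cdot> contract k c \<alpha>"
  "contract k c (\<alpha> + \<alpha>') = contract k c \<alpha> + contract k c \<alpha>'"
  "contract k c (t \<cdot> \<alpha>) = t \<cdot> contract k c \<alpha>"
  "contract k 0 \<alpha> = 0" "contract k c 0 = 0"
  by (auto simp: fun_eq_iff contract_def sum.distrib sum_distrib_left algebra_simps)

lemma contract_sum: "contract k c (\<Sum>i\<in>A. g i) = (\<Sum>i\<in>A. contract k c (g i))"
  by (simp add: fun_eq_iff contract_def sum_fun_apply sum_distrib_right)
    (intro allI sum.swap)

lemma contract_forms:
  assumes c: "c \<in> exterior_forms (k + m)"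
  shows "contract k c \<alpha> \<in> exterior_forms m"
proof -
  have "contract k c \<alpha> = (\<Sum>I\<in>increasing_indices k. \<alpha> (basis_list I) \<cdot> (\<lambda>ws. c (basis_list I @ ws)))"
    by (simp add: fun_eq_iff contract_def sum_fun_apply)
  also have "\<dots> \<in> exterior_forms m"
    using c by (intro forms_sum forms_scale forms_prefix) (simp add: increasing_length)
  finally show ?thesis .
qed

lemma contract_0:
  "contract 0 c \<alpha> = \<alpha> [] \<cdot> c"
proof -
  have "increasing_indices 0 = {[] :: 'a list}" by (auto simp: increasing_indices_def)
  then show ?thesis by (simp add: fun_eq_iff contract_def)
qed

lemma forms_permute_prefix:
  assumes c: "c \<in> exterior_forms m" and s: "\<sigma> permutes {..<length vs}"
  shows "c (permute_list \<sigma> vs @ ws) = of_int (sign \<sigma>) * c (vs @ ws)"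
proof (cases "length vs + length ws = m")
  case True
  then have "(\<lambda>vs. c (vs @ ws)) \<in> exterior_forms (length vs)"
    by (intro forms_suffix) (use c in simp)
  from forms_permute[OF this s] show ?thesis by simp
qed (use forms_length[OF c] in auto)

lemma contract_all_lists:
  fixes c :: "'n::{finite,linorder} form"
  assumes c: "c \<in> exterior_forms m" and a: "\<alpha> \<in> exterior_forms k"
  shows "contract k c \<alpha> ws = (\<Sum>L | length L = k. \<alpha> (basis_list L) * c (basis_list L @ ws)) / fact k"
proof -
  have "(\<Sum>L | length L = k. \<alpha> (basis_list L) * c (basis_list L @ ws)) = fact k * contract k c \<alpha> ws"
    unfolding contract_def
  proof (rule sum_over_lists_eq_sum_over_increasing)
    fix L L' :: "'n list" assume "mset L = mset L'"
    then obtain p where p: "p permutes {..<length L'}" "permute_list p L' = L"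
      by (rule mset_eq_permutation)
    then show "\<alpha> (basis_list L) * c (basis_list L @ ws) = \<alpha> (basis_list L') * c (basis_list L' @ ws)"
      using forms_permute[OF a, of p "basis_list L'"]
        forms_permute_prefix[OF c, of p "basis_list L'" ws]
        basis_list_permute[OF p(1)] by (simp add: sign_def)
  qed (simp add: forms_basis_not_distinct[OF a])
  then show ?thesis by simp
qed

lemma wedge_permute_list:
  "length vs = k + l \<Longrightarrow> wedge k l \<alpha> \<beta> vs =
    (\<Sum>\<sigma> | \<sigma> permutes {..<k + l}. of_int (sign \<sigma>) * \<alpha> (take k (permute_list \<sigma> vs)) *
       \<beta> (drop k (permute_list \<sigma> vs))) / (fact k * fact l)"
  by (simp add: wedge_def permute_list_def take_map drop_map)

lemma permute_list_update:
  assumes "\<sigma> permutes {..<length vs}" "j < length vs"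
  shows "permute_list \<sigma> (vs[j := x]) = (permute_list \<sigma> vs)[inv \<sigma> j := x]"
proof (rule nth_equalityI)
  fix i assume "i < length (permute_list \<sigma> (vs[j := x]))"
  then have i: "i < length vs" by simp
  have "\<sigma> i < length vs" "(\<sigma> i = j) = (i = inv \<sigma> j)"
    using permutes_in_image[OF assms(1), of i] i permutes_inverses[OF assms(1)] by auto
  then show "permute_list \<sigma> (vs[j := x]) ! i = (permute_list \<sigma> vs)[inv \<sigma> j := x] ! i"
    using i assms by (auto simp: permute_list_nth nth_list_update)
qed simp

text \<open>
  Reindexing the sum over all permutations by a translation in the group.
\<close>

lemma wedge_permute:
  fixes \<alpha> \<beta> :: "'n::{finite,linorder} form"
  assumes t: "\<tau> permutes {..<k + l}" and vs: "length vs = k + l"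
  shows "wedge k l \<alpha> \<beta> (permute_list \<tau> vs) = of_int (sign \<tau>) * wedge k l \<alpha> \<beta> vs"
proof -
  define F where "F vs = \<alpha> (take k vs) * \<beta> (drop k vs)" for vs
  have W: "wedge k l \<alpha> \<beta> vs = (\<Sum>\<sigma> | \<sigma> permutes {..<k
    + l}. of_int (sign \<sigma>) * F (permute_list \<sigma> vs)) / (fact k * fact l)"
    if "length vs = k + l" for vs
    using that by (simp add: wedge_permute_list F_def mult.assoc)
  have "(\<Sum>\<sigma> | \<sigma> permutes {..<k + l}. of_int (sign \<sigma>) * F (permute_list \<sigma> vs))
     = (\<Sum>\<sigma> | \<sigma> permutes {..<k + l}. of_int (sign (\<tau> \<circ> \<sigma>)) * F (permute_list (\<tau> \<circ> \<sigma>) vs))"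
    by (rule setum_permutations_compose_left[OF t])
  also have "\<dots> = (\<Sum>\<sigma> | \<sigma> permutes {..<k + l}. of_int (sign \<tau>) *
    (of_int (sign \<sigma>) * F (permute_list \<sigma> (permute_list \<tau> vs))))"
    by (rule sum.cong[OF refl])
       (simp add: sign_compose permutes_imp_permutation[OF _ t]
         permutes_imp_permutation[of "{..<k+l}"] permute_list_compose vs)
  finally have "(\<Sum>\<sigma> | \<sigma> permutes {..<k + l}. of_int (sign \<sigma>) * F (permute_list \<sigma> (permute_list \<tau> vs)))
    = of_int (sign \<tau>) * (\<Sum>\<sigma> | \<sigma> permutes {..<k + l}. of_int (sign \<sigma>) * F (permute_list \<sigma> vs))"
    by (simp add: sign_def sum_distrib_left[symmetric] split: if_splits)
  then show ?thesis by (simp add: W vs)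
qed

lemma wedge_forms [intro]:
  fixes \<alpha> \<beta> :: "'n::{finite,linorder} form"
  assumes a: "\<alpha> \<in> exterior_forms k" and b: "\<beta> \<in> exterior_forms l"
  shows "wedge k l \<alpha> \<beta> \<in> exterior_forms (k + l)"
  unfolding exterior_forms_def
proof (intro CollectI conjI allI impI; (elim conjE)?)
  fix vs :: "(real, 'n) vec list" assume "length vs \<noteq> k + l"
  then show "wedge k l \<alpha> \<beta> vs = 0" by (simp add: wedge_def)
next
  fix vs :: "(real, 'n) vec list" and j assume vs: "length vs = k + l" and j: "j < k + l"
  have "linear (\<lambda>x. of_int (sign \<sigma>) * \<alpha> (take k (permute_list \<sigma> (vs[j := x]))) * \<beta>
    (drop k (permute_list \<sigma> (vs[j := x]))))"
    if s: "\<sigma> permutes {..<k + l}" for \<sigma>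
  proof -
    define i us where "i = inv \<sigma> j" and "us = permute_list \<sigma> vs"
    have i: "i < k + l" using permutes_in_image[OF permutes_inv[OF s], of j] j by (simp add: i_def)
    have us: "length us = k + l" using vs by (simp add: us_def)
    have p: "permute_list \<sigma> (vs[j := x]) = us[i := x]" for x
      using permute_list_update[of \<sigma> vs j x] s j vs by (simp add: i_def us_def)
    show ?thesis
    proof (cases "i < k")
      case True
      have "linear (\<lambda>x. (of_int (sign \<sigma>) * \<beta> (drop k us)) *\<^sub>R \<alpha> ((take k us)[i := x]))"
        using forms_linear[OF a, of "take k us" i] True us by (intro linear_compose_scale_right) auto
      then show ?thesis using True by (simp add: p take_update_swap mult_ac)
    next
      case False
      have "linear (\<lambda>x. (of_int (sign \<sigma>) * \<alpha> (take k us)) *\<^sub>R \<beta> ((drop k us)[i - k := x]))"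
        using forms_linear[OF b, of "drop k us" "i - k"] False us i
          by (intro linear_compose_scale_right) auto
      then show ?thesis using False by (simp add: p drop_update_swap mult_ac)
    qed
  qed
  then have "linear (\<lambda>x. (1 / (fact k * fact l)) *\<^sub>R (\<Sum>\<sigma> | \<sigma> permutes {..<k
    + l}. of_int (sign \<sigma>) * \<alpha> (take k (permute_list \<sigma> (vs[j := x]))) * \<beta>
      (drop k (permute_list \<sigma> (vs[j := x])))))"
    by (intro linear_compose_scale_right linear_compose_sum) auto
  then show "linear (\<lambda>x. wedge k l \<alpha> \<beta> (vs[j := x]))"
    using vs by (simp add: wedge_permute_list)
next
  fix vs :: "(real, 'n) vec list" and i j
  assume vs: "length vs = k + l" and ij: "i < j" "j < k + l" "vs ! i = vs ! j"
  have t: "Transposition.transpose i j permutes {..<k + l}"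
    using ij by (intro permutes_swap_id) auto
  have "permute_list (Transposition.transpose i j) vs = vs"
    using ij vs by (simp add: permute_list_transpose) (metis list_update_id)
  with wedge_permute[OF t vs, of \<alpha> \<beta>] ij show "wedge k l \<alpha> \<beta> vs = 0"
    by (simp add: sign_swap_id)
qed

text \<open>
  Contraction with a product is iterated contraction; at \<open>m = 0\<close> this says that contraction with
  \<open>\<alpha>\<close> is adjoint to multiplication by \<open>\<alpha>\<close>. Written over all lists of indices, the sign of each
  permutation in the exterior product is absorbed by \<open>c\<close>, so that every permutation contributes
  the same sum and a list splits freely into its two blocks.
\<close>

lemma contract_wedge:
  fixes c \<alpha> \<beta> :: "'n::{finite,linorder} form"
  assumes c: "c \<in> exterior_forms (k + l + m)" and a: "\<alpha> \<in> exterior_forms k"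
    and b: "\<beta> \<in> exterior_forms l"
  shows "contract (k + l) c (wedge k l \<alpha> \<beta>) = contract l (contract k c \<alpha>) \<beta>"
proof
  fix ws
  define F where "F L = \<alpha> (basis_list (take k L)) * \<beta> (basis_list (drop k L)) * c
    (basis_list L @ ws)" for L
  let ?LL = "{L :: 'n list. length L = k + l}"
  have inv: "(\<Sum>L\<in>?LL. F (permute_list \<sigma> L)) = (\<Sum>L\<in>?LL. F L)" if s: "\<sigma> permutes {..<k + l}" for \<sigma>
  proof (rule sum.reindex_bij_witness[of _ "permute_list (inv \<sigma>)" "permute_list \<sigma>"])
    fix L :: "'n list" assume "L \<in> ?LL"
    then show "permute_list (inv \<sigma>) (permute_list \<sigma> L) = L" "permute_list \<sigma> (permute_list (inv \<sigma>) L)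
      = L"
      using s permutes_inv[OF s] by (simp_all add: permute_list_compose[symmetric] permutes_inv_o[OF s])
  qed auto
  have "contract (k + l) c (wedge k l \<alpha> \<beta>) ws
      = (\<Sum>L\<in>?LL. wedge k l \<alpha> \<beta> (basis_list L) * c (basis_list L @ ws)) / fact (k + l)"
    by (rule contract_all_lists[OF c wedge_forms[OF a b]])
  also have "(\<Sum>L\<in>?LL. wedge k l \<alpha> \<beta> (basis_list L) * c (basis_list L @ ws))
     = (\<Sum>L\<in>?LL. \<Sum>\<sigma> | \<sigma> permutes {..<k + l}. F (permute_list \<sigma> L) / (fact k * fact l))"
  proof (rule sum.cong[OF refl])
    fix L :: "'n list" assume "L \<in> ?LL"
    then have L: "length L = k + l" by simp
    have "of_int (sign \<sigma>) * \<alpha> (take k (permute_list \<sigma> (basis_list L))) * \<beta>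
      (drop k (permute_list \<sigma> (basis_list L)))
        * c (basis_list L @ ws) = F (permute_list \<sigma> L)" if s: "\<sigma> permutes {..<k + l}" for \<sigma>
    proof -
      have "c (basis_list L @ ws) = of_int (sign \<sigma>) * c (permute_list \<sigma> (basis_list L) @ ws)"
        using forms_permute_prefix[OF c, of \<sigma> "basis_list L" ws] s L by (simp add: sign_def)
      moreover have "permute_list \<sigma> (basis_list L) = basis_list (permute_list \<sigma> L)"
        using s L by (simp add: basis_list_permute)
      moreover have "take k (basis_list M) = basis_list (take k M)" "drop k (basis_list M)
        = basis_list (drop k M)" for M :: "'n list"
        by (simp_all add: basis_list_def take_map drop_map)
      ultimately show ?thesis by (simp add: F_def sign_def)
    qed
    then show "wedge k l \<alpha> \<beta> (basis_list L) * c (basis_list L @ ws)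
       = (\<Sum>\<sigma> | \<sigma> permutes {..<k + l}. F (permute_list \<sigma> L) / (fact k * fact l))"
      using L by (simp add: wedge_permute_list sum_distrib_right sum_divide_distrib)
  qed
  also have "\<dots> = (\<Sum>\<sigma> | \<sigma> permutes {..<k + l}. \<Sum>L\<in>?LL. F (permute_list \<sigma> L) / (fact k * fact l))"
    by (rule sum.swap)
  also have "\<dots> = (\<Sum>\<sigma> | \<sigma> permutes {..<k + l}. (\<Sum>L\<in>?LL. F L) / (fact k * fact l))"
    by (rule sum.cong[OF refl]) (simp add: inv flip: sum_divide_distrib)
  also have "\<dots> = fact (k + l) * ((\<Sum>L\<in>?LL. F L) / (fact k * fact l))"
    by (simp add: card_permutations[of "{..<k + l}" "k + l"])
  also have "(\<Sum>L\<in>?LL. F L) = (\<Sum>(I, J)\<in>{I. length I = k} \<times> {J. length J = l}. 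
      \<alpha> (basis_list I) * \<beta> (basis_list J) * c (basis_list I @ basis_list J @ ws))"
    by (rule sum.reindex_bij_witness[of _ "\<lambda>(I, J). I @ J" "\<lambda>L. (take k L, drop k L)"])
       (auto simp: F_def simp flip: append_assoc basis_list_simps(3))
  also have "\<dots> = (\<Sum>J | length J = l. \<beta> (basis_list J) * (\<Sum>I | length I
    = k. \<alpha> (basis_list I) * c (basis_list I @ basis_list J @ ws)))"
    by (subst sum.cartesian_product[symmetric], subst sum.swap) (simp add: sum_distrib_left mult_ac)
  also have "\<dots> = (\<Sum>J | length J = l. \<beta> (basis_list J) * (fact k * contract k c \<alpha> (basis_list J @ ws)))"
    by (simp add: contract_all_lists[OF c a])
  also have "\<dots> = fact k * fact l * contract l (contract k c \<alpha>) \<beta> ws"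
    using contract_all_lists[OF contract_forms[of c k "l + m" \<alpha>] b, of ws] c
    by (simp add: add.assoc mult.left_commute flip: sum_distrib_left)
  finally show "contract (k + l) c (wedge k l \<alpha> \<beta>) ws = contract l (contract k c \<alpha>) \<beta> ws"
    by simp
qed

lemma wedge_linear:
  "wedge k l (\<alpha> + \<alpha>') \<beta> = wedge k l \<alpha> \<beta> + wedge k l \<alpha>' \<beta>"
  "wedge k l (t \<cdot> \<alpha>) \<beta> = t \<cdot> wedge k l \<alpha> \<beta>"
  "wedge k l \<alpha> (\<beta> + \<beta>') = wedge k l \<alpha> \<beta> + wedge k l \<alpha> \<beta>'"
  "wedge k l \<alpha> (t \<cdot> \<beta>) = t \<cdot> wedge k l \<alpha> \<beta>"
  "wedge k l 0 \<beta> = 0" "wedge k l \<alpha> 0 = 0"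
  by (auto simp: fun_eq_iff wedge_def add_divide_distrib[symmetric] sum.distrib[symmetric]
      sum_distrib_left algebra_simps intro!: sum.cong)

section \<open>Covectors and decomposable forms\<close>

definition one_form :: "real ^ ('n::{finite,linorder}) \<Rightarrow> 'n form"
  where "one_form x vs = (case vs of [v] \<Rightarrow> x \<bullet> v | _ \<Rightarrow> 0)"

lemma form_vector_one_form [simp]: "form_vector (one_form x) = x"
  by (simp add: form_vector_def one_form_def vec_eq_iff inner_axis)

lemma one_form_forms: "one_form x \<in> exterior_forms 1"
  by (auto simp: exterior_forms_def one_form_def length_Suc_conv linear_iff inner_add_right split:
    list.splits)

lemmas one_form_forms' [simp] = one_form_forms one_form_forms[unfolded One_nat_def]

lemma increasing_indices_1: "increasing_indices 1 = range (\<lambda>i. [i])"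
  by (auto simp: increasing_indices_def length_Suc_conv)

lemma interior_product_eq_contract:
  assumes c: "c \<in> exterior_forms (Suc m)"
  shows "contract 1 c a = interior_product a c"
proof
  fix ws
  have "contract 1 c a ws = (\<Sum>i\<in>UNIV. a [axis i 1] * c (axis i 1 # ws))"
    unfolding contract_def increasing_indices_1 by (subst sum.reindex) (auto simp: inj_on_def)
  also have "\<dots> = interior_product a c ws"
    using forms_expand_first[OF c, of "form_vector a" ws]
    by (simp add: interior_product_def form_vector_def)
  finally show "contract 1 c a ws = interior_product a c ws" .
qed

lemma one_form_apply:
  assumes a: "a \<in> exterior_forms 1"
  shows "a [v] = form_vector a \<bullet> v"
  using forms_expand_first[of a 0 v "[]"] a by (simp add: form_vector_def inner_vec_def mult.commute)

lemma interior_product_forms [intro]: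
  "c \<in> exterior_forms (Suc m) \<Longrightarrow> interior_product a c \<in> exterior_forms m"
  unfolding interior_product_def by (rule forms_Cons)

lemma interior_product_linear:
  "interior_product a (c + c') = interior_product a c + interior_product a c'"
  "interior_product a (t \<cdot> c) = t \<cdot> interior_product a c"
  "interior_product a 0 = 0"
  by (auto simp: fun_eq_iff interior_product_def)

lemma contract_wedge_one:
  assumes c: "c \<in> exterior_forms (Suc l + m)" and a: "a \<in> exterior_forms 1"
    and b: "\<beta> \<in> exterior_forms l"
  shows "contract (Suc l) c (wedge 1 l a \<beta>) = contract l (interior_product a c) \<beta>"
  using contract_wedge[of c 1 l m a \<beta>] assms interior_product_eq_contract[of c "l + m" a] by simp

text \<open>
  The scalar product is positive definite, so it may be tested against the difference of the two
  forms.
\<close>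

lemma forms_eqI_inner:
  assumes w: "\<omega> \<in> exterior_forms k" "\<omega>' \<in> exterior_forms k"
    and eq: "\<And>c. c \<in> exterior_forms k \<Longrightarrow> contract k c \<omega> [] = contract k c \<omega>' []"
  shows "\<omega> = \<omega>'"
proof (rule forms_eqI[OF w])
  fix I :: "'a list" assume I: "I \<in> increasing_indices k"
  let ?d = "\<omega> + (-1) \<cdot> \<omega>'"
  have "contract k ?d ?d [] = 0"
    using eq[of ?d] w forms_add[OF w(1) forms_scale[OF w(2)]] by (simp add: contract_linear(3,4))
  then have "(\<Sum>I\<in>increasing_indices k. ?d (basis_list I) * ?d (basis_list I)) = 0"
    by (simp add: contract_def)
  then have "?d (basis_list I) * ?d (basis_list I) = 0"
    using I by (subst (asm) sum_nonneg_eq_0_iff) auto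
  then show "\<omega> (basis_list I) = \<omega>' (basis_list I)" by simp
qed

text \<open>
  The product \<open>v\<^sub>1 \<and> \<dots> \<and> v\<^sub>k\<close> of the covectors dual to the given vectors.
\<close>

primrec decomposable :: "(real ^ ('n::{finite,linorder})) list \<Rightarrow> 'n form"
  where
    "decomposable [] = unit_form"
  | "decomposable (v # vs) = wedge 1 (length vs) (one_form v) (decomposable vs)"

lemma decomposable_forms: "decomposable vs \<in> exterior_forms (length vs)"
proof (induction vs)
  case (Cons v vs)
  then show ?case using wedge_forms[OF one_form_forms[of v] Cons.IH] by simp
qed simp

text \<open>
  This identity characterises decomposable forms. Through it their dependence on the factors is
  read off without computing any exterior product.
\<close>

lemma contract_decomposable:
  "c \<in> exterior_forms (length vs + m) \<Longrightarrow> contract (length vs) c (decomposable vs) = (\<lambda>ws. c (vs @ ws))"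
proof (induction vs arbitrary: c)
  case Nil
  then show ?case by (auto simp: contract_0 unit_form_def fun_eq_iff)
next
  case (Cons v vs)
  have "contract (length (v # vs)) c (decomposable (v # vs))
    = contract (length vs) (interior_product (one_form v) c) (decomposable vs)"
    using contract_wedge_one[of c "length vs" m "one_form v" "decomposable vs"] Cons.prems
    by (simp add: decomposable_forms)
  also have "\<dots> = (\<lambda>ws. interior_product (one_form v) c (vs @ ws))"
    by (rule Cons.IH) (use Cons.prems interior_product_forms[of c "length vs + m"] in simp)
  finally show ?case by (simp add: interior_product_def)
qed

text \<open>
  Symmetry of the scalar product of two decomposable forms. As a function of its factors, each
  coefficient of a decomposable form is thus itself an alternating form.
\<close>

lemma decomposable_coefficient:
  assumes "length vs = length K"
  shows "decomposable vs (basis_list K) = decomposable (basis_list K) vs"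
proof -
  let ?k = "length K"
  have "decomposable vs (basis_list K) = contract ?k (decomposable vs) (decomposable (basis_list K)) []"
    using contract_decomposable[of "decomposable vs" "basis_list K" 0] decomposable_forms[of vs]
      assms by simp
  also have "\<dots> = contract ?k (decomposable (basis_list K)) (decomposable vs) []"
    by (simp add: contract_def mult.commute)
  also have "\<dots> = decomposable (basis_list K) vs"
    using contract_decomposable[of "decomposable (basis_list K)" vs 0]
      decomposable_forms[of "basis_list K"] assms by simp
  finally show ?thesis .
qed

lemma decomposable_forms': "length vs = k \<Longrightarrow> decomposable vs \<in> exterior_forms k"
  using decomposable_forms by blast

lemma decomposable_update_add:
  assumes "i < length vs"
  shows "decomposable (vs[i := x + y]) = decomposable (vs[i := x]) + decomposable (vs[i := y])"
proof (rule forms_eqI[of _ "length vs"])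
  fix I :: "'a list" assume "I \<in> increasing_indices (length vs)"
  then have I: "length I = length vs" by (rule increasing_length)
  then have lin: "linear (\<lambda>x. decomposable (basis_list I) (vs[i := x]))"
    using assms by (intro forms_linear[OF decomposable_forms]) auto
  then show "decomposable (vs[i := x + y]) (basis_list I)
     = (decomposable (vs[i := x]) + decomposable (vs[i := y])) (basis_list I)"
    by (simp add: decomposable_coefficient I linear_add[OF lin])
qed (auto intro!: decomposable_forms' forms_add)

lemma decomposable_update_scale:
  assumes "i < length vs"
  shows "decomposable (vs[i := t *\<^sub>R x]) = t \<cdot> decomposable (vs[i := x])"
proof (rule forms_eqI[of _ "length vs"])
  fix I :: "'a list" assume "I \<in> increasing_indices (length vs)"
  then have I: "length I = length vs" by (rule increasing_length)
  then have lin: "linear (\<lambda>x. decomposable (basis_list I) (vs[i := x]))"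
    using assms by (intro forms_linear[OF decomposable_forms]) auto
  then show "decomposable (vs[i := t *\<^sub>R x]) (basis_list I)
     = (t \<cdot> decomposable (vs[i := x])) (basis_list I)"
    by (simp add: decomposable_coefficient I linear_scale[OF lin])
qed (auto intro!: decomposable_forms' forms_scale)

lemma decomposable_repeat:
  assumes "\<not> distinct vs"
  shows "decomposable vs = 0"
proof (rule forms_eqI[of _ "length vs"])
  fix I :: "'a list" assume "I \<in> increasing_indices (length vs)"
  then have I: "length I = length vs" by (rule increasing_length)
  show "decomposable vs (basis_list I) = 0 (basis_list I)"
    using forms_not_distinct[OF decomposable_forms assms, of "basis_list I"] I
    by (simp add: decomposable_coefficient)
qed (auto intro!: decomposable_forms)

text \<open>
  Each factor can be moved to the front at the cost of a sign. Hence two decomposable forms with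
  a common factor lie on a common space of directions \<open>x \<and> \<gamma>\<close>.
\<close>

lemma decomposable_divisible:
  assumes "x \<in> set vs"
  obtains \<gamma> where "\<gamma> \<in> exterior_forms (length vs - 1)"
    "decomposable vs = wedge 1 (length vs - 1) (one_form x) \<gamma>"
proof -
  obtain us ws where vs: "vs = us @ x # ws" using split_list[OF assms] by blast
  let ?s = "(-1) ^ length us"
  have l: "length vs - 1 = length (us @ ws)" by (simp add: vs)
  have "decomposable vs = ?s \<cdot> decomposable (x # us @ ws)"
  proof (rule forms_eqI[of _ "length vs"])
    fix I :: "'a list" assume "I \<in> increasing_indices (length vs)"
    then have I: "length I = length vs" by (rule increasing_length)
    show "decomposable vs (basis_list I) = (?s \<cdot> decomposable (x # us @ ws)) (basis_list I)"
      using forms_move_to_front[OF decomposable_forms, of "basis_list I" us x ws] I vs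
        decomposable_coefficient[of "x # us @ ws" I]
      by (simp add: decomposable_coefficient del: decomposable.simps)
  qed (auto intro!: decomposable_forms' forms_scale simp: vs simp del: decomposable.simps)
  also have "\<dots> = wedge 1 (length vs - 1) (one_form x) (?s \<cdot> decomposable (us @ ws))"
    unfolding l by (simp add: wedge_linear)
  finally show ?thesis
    by (rule that[rotated]) (unfold l, intro forms_scale decomposable_forms)
qed

lemma form_expansion:
  assumes w: "\<omega> \<in> exterior_forms k"
  shows "\<omega> = (\<Sum>I\<in>increasing_indices k. \<omega> (basis_list I) \<cdot> decomposable (basis_list I))"
proof (rule forms_eqI_inner[OF w])
  show "(\<Sum>I\<in>increasing_indices k. \<omega> (basis_list I) \<cdot> decomposable (basis_list I)) \<in> exterior_forms k"
    by (intro forms_sum forms_scale decomposable_forms') (simp add: increasing_length)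
  fix c :: "'a form" assume c: "c \<in> exterior_forms k"
  have "contract k c (\<Sum>I\<in>increasing_indices k. \<omega> (basis_list I) \<cdot> decomposable (basis_list I)) []
     = (\<Sum>I\<in>increasing_indices k. \<omega> (basis_list I) * contract k c (decomposable (basis_list I)) [])"
    by (simp add: contract_sum sum_fun_apply contract_linear)
  also have "\<dots> = (\<Sum>I\<in>increasing_indices k. \<omega> (basis_list I) * c (basis_list I))"
  proof (rule sum.cong[OF refl])
    fix I :: "'a list" assume I: "I \<in> increasing_indices k"
    show "\<omega> (basis_list I) * contract k c (decomposable (basis_list I)) []
      = \<omega> (basis_list I) * c (basis_list I)"
      using contract_decomposable[of c "basis_list I" 0] c increasing_length[OF I] by simp
  qed
  finally show "contract k c \<omega> [] = contract k c
    (\<Sum>I\<in>increasing_indices k. \<omega> (basis_list I) \<cdot> decomposable (basis_list I)) []"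
    by (simp add: contract_def)
qed

section \<open>Exterior and interior multiplication by the same covector\<close>

text \<open>
  Permutations that fix the first position act on the remaining arguments with their own sign.
  The positions are not renumbered, so the shift of indices is confined to this proof.
\<close>

lemma forms_permute_tail:
  assumes b: "\<beta> \<in> exterior_forms k" and q: "q permutes {1..<Suc k}" and vs: "length vs = Suc k"
  shows "\<beta> (tl (permute_list q vs)) = of_int (sign q) * \<beta> (tl vs)"
  using finite_atLeastLessThan q
proof (induction q rule: permutes_rev_induct)
  case (swap a b p)
  obtain a' b' where ab: "a = Suc a'" "b = Suc b'" using swap.hyps by (cases a; cases b) auto
  have t: "Transposition.transpose a b permutes {..<length vs}"
    by (rule permutes_swap_id) (use swap vs in auto)
  have "\<beta> (tl (permute_list (p \<circ> Transposition.transpose a b) vs))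
    = \<beta> (tl (permute_list (Transposition.transpose a b) (permute_list p vs)))"
    by (simp add: permute_list_compose[OF t])
  also have "\<dots> = - \<beta> (tl (permute_list p vs))"
  proof -
    obtain u us where us: "permute_list p vs = u # us"
      using vs by (metis length_Suc_conv length_permute_list)
    have "length us = k" using arg_cong[OF us, of length] vs by simp
    then show ?thesis using swap.hyps forms_swap[OF b, of a' us b'] unfolding us
      by (simp add: permute_list_transpose ab)
  qed
  also have "\<dots> = of_int (sign (p \<circ> Transposition.transpose a b)) * \<beta> (tl vs)"
    using swap permutes_imp_permutation[OF _ t] permutes_imp_permutation[OF _ \<open>p permutes {1..<Suc k}\<close>]
    by (simp add: sign_compose sign_swap_id)
  finally show ?case .
qed simp

text \<open>
  The expansion along the first argument, with \<open>u\<close> put in the place of \<open>ws ! j\<close> instead of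
  listing the arguments without \<open>ws ! j\<close>: a permutation with \<open>0 \<mapsto> j + 1\<close> is a transposition
  followed by a permutation that fixes 0. No alternating signs in \<open>j\<close> occur in this form.
\<close>

lemma wedge_one_Cons:
  assumes b: "\<beta> \<in> exterior_forms k" and ws: "length ws = k"
  shows "wedge 1 k a \<beta> (u # ws) = a [u] * \<beta> ws - (\<Sum>j<k. a [ws ! j] * \<beta> (ws[j := u]))"
proof -
  let ?S = "{1..<Suc k}" and ?vs = "u # ws"
  let ?t = "Transposition.transpose (0::nat)"
  define V where "V i = permute_list (?t i) ?vs" for i
  define f where "f \<sigma> = of_int (sign \<sigma>) * a (take 1 (permute_list \<sigma> ?vs)) * \<beta>
    (drop 1 (permute_list \<sigma> ?vs))" for \<sigma>
  have I: "{..<1 + k} = insert 0 ?S" by auto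
  have V0: "V 0 = ?vs" by (simp add: V_def)
  have VS: "V (Suc j) = ws ! j # ws[j := u]" if "j < k" for j
    using that ws by (simp add: V_def permute_list_transpose)
  have f: "f (?t i \<circ> q) = of_int (sign (?t i)) * (a [hd (V i)] * \<beta> (tl (V i)))"
    if q: "q permutes ?S" and i: "i < Suc k" for i q
  proof -
    have q': "q permutes {..<length ?vs}" using permutes_subset[OF q] ws by force
    have q0: "q 0 = 0" using q by (simp add: permutes_def)
    have VL: "length (V i) = Suc k" by (simp add: V_def ws)
    have P: "permute_list (?t i \<circ> q) ?vs = permute_list q (V i)"
      using permute_list_compose[OF q'] by (simp add: V_def)
    have "take 1 (permute_list q (V i)) = [hd (V i)]"
    proof -
      have ne: "permute_list q (V i) \<noteq> []" "V i \<noteq> []" using VL by (auto simp flip: length_0_conv)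
      have "permute_list q (V i) ! 0 = V i ! 0"
        using VL q0 permute_list_nth[of q "V i" 0] q' ws by simp
      then show ?thesis using ne by (simp add: take_Suc hd_conv_nth)
    qed
    moreover have "drop 1 (permute_list q (V i)) = tl (permute_list q (V i))" by (simp add: drop_Suc)
    moreover have "permutation (?t i)" "permutation q"
      using q permutes_imp_permutation by (auto simp: permutation_swap_id)
    ultimately show ?thesis
      using forms_permute_tail[OF b q VL] by (simp add: f_def P sign_compose) (simp add: sign_def)
  qed
  have "wedge 1 k a \<beta> ?vs = (\<Sum>\<sigma> | \<sigma> permutes {..<1 + k}. f \<sigma>) / fact k"
    using ws by (simp add: wedge_permute_list f_def)
  also have "(\<Sum>\<sigma> | \<sigma> permutes {..<1 + k}. f \<sigma>) = (\<Sum>i\<in>insert 0 ?S. \<Sum>q | q permutes ?S. f (?t i \<circ> q))"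
    unfolding I by (rule sum_over_permutations_insert) auto
  also have "\<dots> = (\<Sum>i\<in>insert 0 ?S. fact k * (of_int (sign (?t i)) * (a [hd (V i)] * \<beta> (tl (V i)))))"
  proof (rule sum.cong[OF refl])
    fix i assume "i \<in> insert 0 ?S"
    then have "i < Suc k" by auto
    then have "(\<Sum>q | q permutes ?S. f (?t i \<circ> q))
       = (\<Sum>q | q permutes ?S. of_int (sign (?t i)) * (a [hd (V i)] * \<beta> (tl (V i))))"
      by (intro sum.cong refl) (use f in auto)
    also have "\<dots> = real (card {q. q permutes ?S}) *
      (of_int (sign (?t i)) * (a [hd (V i)] * \<beta> (tl (V i))))"
      by simp
    also have "card {q. q permutes ?S} = fact k" by (rule card_permutations) auto
    finally show "(\<Sum>q | q permutes ?S. f (?t i \<circ> q))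
       = fact k * (of_int (sign (?t i)) * (a [hd (V i)] * \<beta> (tl (V i))))" by (simp only: of_nat_fact)
  qed
  also have "\<dots> = fact k * (\<Sum>i\<in>insert 0 ?S. of_int (sign (?t i)) * (a [hd (V i)] * \<beta> (tl (V i))))"
    by (simp only: sum_distrib_left)
  also have "insert 0 ?S = {..<Suc k}" by auto
  also have "(\<Sum>i<Suc k. of_int (sign (?t i)) * (a [hd (V i)] * \<beta> (tl (V i)))) =
     a [u] * \<beta> ws + (\<Sum>j<k. - (a [ws ! j] * \<beta> (ws[j := u])))"
    by (subst sum.lessThan_Suc_shift) (simp add: V0 VS sign_swap_id)
  finally show ?thesis by (simp add: sum_negf)
qed

text \<open>
  Both terms are evaluated at a list starting with \<open>u\<close>. The expansion of \<open>a \<and> \<beta>\<close> at the vector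
  of \<open>a\<close> contains, after exchanging two arguments of \<open>\<beta>\<close>, the terms of the expansion of
  \<open>a \<and> (a \<lrcorner> \<beta>)\<close> at \<open>u\<close> with the opposite sign; its leading term remains.
\<close>

lemma interior_wedge_anticommute:
  assumes a: "a \<in> exterior_forms 1" and b: "\<beta> \<in> exterior_forms (Suc k)"
  shows "interior_product a (wedge 1 (Suc k) a \<beta>) + wedge 1 k a (interior_product a \<beta>)
       = (norm (form_vector a))\<^sup>2 \<cdot> \<beta>"
proof -
  let ?x = "form_vector a"
  have L: "interior_product a (wedge 1 (Suc k) a \<beta>) \<in> exterior_forms (Suc k)"
    by (intro interior_product_forms) (use wedge_forms[OF a b] in simp)
  have R: "wedge 1 k a (interior_product a \<beta>) \<in> exterior_forms (Suc k)"
    using wedge_forms[OF a interior_product_forms[OF b]] by simp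
  show ?thesis
  proof
    fix vs
    show "(interior_product a (wedge 1 (Suc k) a \<beta>) + wedge 1 k a (interior_product a \<beta>)) vs
       = ((norm ?x)\<^sup>2 \<cdot> \<beta>) vs"
    proof (cases "length vs = Suc k")
      case False
      then show ?thesis using forms_length[OF L, of vs] forms_length[OF R, of vs]
        forms_length[OF b, of vs] by simp
    next
      case True
      then obtain u ws where vs: "vs = u # ws" and ws: "length ws = k" by (cases vs) auto
      have sw: "\<beta> (u # ws[j := ?x]) = - \<beta> (?x # ws[j := u])" if "j < k" for j
        using that ws forms_swap[OF b, of 0 "?x # ws[j := u]" "Suc j"] by simp
      have "interior_product a (wedge 1 (Suc k) a \<beta>) vs
        = a [?x] * \<beta> vs - (\<Sum>j<Suc k. a [vs ! j] * \<beta> (vs[j := ?x]))"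
        using wedge_one_Cons[OF b True] by (simp add: interior_product_def del: sum.lessThan_Suc)
      also have "(\<Sum>j<Suc k. a [vs ! j] * \<beta> (vs[j := ?x]))
         = a [u] * \<beta> (?x # ws) - (\<Sum>j<k. a [ws ! j] * \<beta> (?x # ws[j := u]))"
        by (subst sum.lessThan_Suc_shift) (simp add: vs sw sum_negf)
      finally show ?thesis
        using wedge_one_Cons[OF interior_product_forms[OF b] ws, of a a u]
        by (simp add: vs interior_product_def one_form_apply[OF a, of ?x] power2_norm_eq_inner)
    qed
  qed
qed

lemma interior_product_twice:
  assumes "c \<in> exterior_forms k"
  shows "interior_product a (interior_product a c) = 0"
  by (auto simp: fun_eq_iff interior_product_def intro!: forms_repeated_front[OF assms])

lemma interior_product_zeroD: "interior_product a c = 0 \<Longrightarrow> c (form_vector a # ws) = 0"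
  by (metis interior_product_def zero_fun_apply)

lemma wedge_one_twice:
  assumes a: "a \<in> exterior_forms 1" and b: "\<beta> \<in> exterior_forms k"
  shows "wedge 1 (Suc k) a (wedge 1 k a \<beta>) = 0"
proof (rule forms_eqI_inner[of _ "Suc (Suc k)"])
  have w: "wedge 1 k a \<beta> \<in> exterior_forms (Suc k)" using wedge_forms[OF a b] by simp
  show "wedge 1 (Suc k) a (wedge 1 k a \<beta>) \<in> exterior_forms (Suc (Suc k))"
    using wedge_forms[OF a w] by simp
  fix c :: "'a form" assume c: "c \<in> exterior_forms (Suc (Suc k))"
  show "contract (Suc (Suc k)) c (wedge 1 (Suc k) a (wedge 1 k a \<beta>)) [] = contract (Suc (Suc k)) c 0 []"
    using contract_wedge_one[of c "Suc k" 0 a "wedge 1 k a \<beta>"]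
      contract_wedge_one[of "interior_product a c" k 0 a \<beta>]
      a b w c interior_product_forms[OF c] by (simp add: interior_product_twice contract_linear)
qed simp

text \<open>
  For a unit covector \<open>a\<close>, the maps \<open>a \<lrcorner> (a \<and> \<cdot>)\<close> and \<open>a \<and> (a \<lrcorner> \<cdot>)\<close> are complementary
  projections. So \<open>a \<and> b\<close> depends on one component of \<open>b\<close> only and \<open>a \<lrcorner> b\<close> on the other, and
  they can be prescribed independently.
\<close>

lemma decoupling:
  assumes a: "a \<in> exterior_forms 1" and b: "\<beta> \<in> exterior_forms (Suc k)" "\<gamma> \<in> exterior_forms (Suc k)"
  obtains b where "b \<in> exterior_forms (Suc k)" "wedge 1 (Suc k) a b = wedge 1 (Suc k) a \<beta>"
    "interior_product a b = interior_product a \<gamma>"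
proof (cases "form_vector a = 0")
  case True
  have "a = 0"
    by (rule forms_eqI[OF a forms_zero])
      (auto simp: increasing_indices_1[unfolded One_nat_def] one_form_apply[OF a] True)
  then have "interior_product a \<beta> = interior_product a \<gamma>"
    using interior_product_eq_contract[OF b(1), of a] interior_product_eq_contract[OF b(2), of a]
    by (simp add: contract_linear)
  with b show ?thesis by (intro that[of \<beta>]) auto
next
  case False
  define N where "N = (norm (form_vector a))\<^sup>2"
  have N: "N \<noteq> 0" using False by (simp add: N_def)
  define P where "P \<omega> = (1 / N) \<cdot> interior_product a (wedge 1 (Suc k) a \<omega>)" for \<omega>
  define Q where "Q \<omega> = (1 / N) \<cdot> wedge 1 k a (interior_product a \<omega>)" for \<omega>
  have PQ: "P \<omega> + Q \<omega> = \<omega>" if "\<omega> \<in> exterior_forms (Suc k)" for \<omega>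
  proof -
    have "P \<omega> + Q \<omega> = (1 / N) \<cdot> (interior_product a (wedge 1 (Suc k) a \<omega>)
      + wedge 1 k a (interior_product a \<omega>))"
      by (simp add: P_def Q_def fun_eq_iff algebra_simps)
    then show ?thesis using N interior_wedge_anticommute[OF a that] by (simp flip: N_def)
  qed
  have wf: "wedge 1 (Suc k) a \<omega> \<in> exterior_forms (Suc (Suc k))" if "\<omega> \<in> exterior_forms (Suc k)" for \<omega>
    using wedge_forms[OF a that] by simp
  have P: "P \<omega> \<in> exterior_forms (Suc k)" "interior_product a (P \<omega>) = 0"
    if "\<omega> \<in> exterior_forms (Suc k)" for \<omega>
    using wf[OF that] by (auto simp: P_def interior_product_linear interior_product_twice)
  have Q: "Q \<omega> \<in> exterior_forms (Suc k)" "wedge 1 (Suc k) a (Q \<omega>) = 0"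
    if "\<omega> \<in> exterior_forms (Suc k)" for \<omega>
    using interior_product_forms[OF that, of a] wedge_forms[OF a interior_product_forms[OF that, of a]]
      wedge_one_twice[OF a interior_product_forms[OF that, of a]]
    by (auto simp: Q_def wedge_linear)
  show ?thesis
  proof (rule that[of "P \<beta> + Q \<gamma>"])
    show "P \<beta> + Q \<gamma> \<in> exterior_forms (Suc k)" using P Q b by blast
    have "wedge 1 (Suc k) a (P \<beta> + Q \<gamma>) = wedge 1 (Suc k) a (P \<beta> + Q \<beta>)"
      using Q b by (simp add: wedge_linear)
    then show "wedge 1 (Suc k) a (P \<beta> + Q \<gamma>) = wedge 1 (Suc k) a \<beta>" using PQ b by simp
    have "interior_product a (P \<beta> + Q \<gamma>) = interior_product a (P \<gamma> + Q \<gamma>)"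
      using P b by (simp add: interior_product_linear)
    then show "interior_product a (P \<beta> + Q \<gamma>) = interior_product a \<gamma>" using PQ b by simp
  qed
qed

lemma wedge_one_commute:
  assumes a: "a \<in> exterior_forms 1" and g: "\<gamma> \<in> exterior_forms l"
  shows "wedge l 1 \<gamma> a = (-1) ^ l \<cdot> wedge 1 l a \<gamma>"
proof (rule forms_eqI_inner[of _ "Suc l"])
  show "wedge l 1 \<gamma> a \<in> exterior_forms (Suc l)" using wedge_forms[OF g a] by simp
  show "(-1) ^ l \<cdot> wedge 1 l a \<gamma> \<in> exterior_forms (Suc l)" using forms_scale[OF wedge_forms[OF a g]]
    by simp
  fix c :: "'a form" assume c: "c \<in> exterior_forms (Suc l)"
  let ?x = "form_vector a"
  have "contract (Suc l) c (wedge l 1 \<gamma> a) = interior_product a (contract l c \<gamma>)"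
    using contract_wedge[of c l 1 0 \<gamma> a] c a g
      interior_product_eq_contract[OF contract_forms[of c l 1 \<gamma>, unfolded One_nat_def], of a] by simp
  then have "contract (Suc l) c (wedge l 1 \<gamma> a) []
    = (\<Sum>J\<in>increasing_indices l. \<gamma> (basis_list J) * c (basis_list J @ [?x]))"
    by (simp add: interior_product_def contract_def)
  also have "\<dots> = (\<Sum>J\<in>increasing_indices l. (-1) ^ l * (\<gamma> (basis_list J) * c (?x # basis_list J)))"
    using forms_move_to_front[OF c, of "basis_list _" ?x "[]"]
    by (intro sum.cong refl) (simp add: increasing_length)
  also have "\<dots> = (-1) ^ l * contract (Suc l) c (wedge 1 l a \<gamma>) []"
    using contract_wedge_one[of c l 0 a \<gamma>] c a g
    by (simp add: contract_def[of l] interior_product_def sum_distrib_left)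
  finally show "contract (Suc l) c (wedge l 1 \<gamma> a) []
    = contract (Suc l) c ((-1) ^ l \<cdot> wedge 1 l a \<gamma>) []"
    by (simp add: contract_linear)
qed

section \<open>The Hodge star\<close>

definition index_position :: "'n::{finite,linorder} \<Rightarrow> nat"
  where "index_position i = card {j. j < i}"

lemma index_position_less: "index_position (i :: 'n::{finite,linorder}) < CARD('n)"
  unfolding index_position_def by (rule psubset_card_mono) auto

lemma index_position_inj: "inj (index_position :: 'n::{finite,linorder} \<Rightarrow> nat)"
proof (rule injI)
  have *: "index_position i < index_position j" if "i < j" for i j :: 'n
    unfolding index_position_def by (rule psubset_card_mono) (use that in auto)
  fix i j :: 'n assume "index_position i = index_position j"
  then show "i = j" using *[of i j] *[of j i] by (cases i j rule: linorder_cases) auto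
qed

lemma index_position_surj:
  assumes "m < CARD('n)"
  obtains i :: "'n::{finite,linorder}" where "index_position i = m"
proof -
  have "index_position ` (UNIV :: 'n set) = {..<CARD('n)}"
    by (rule card_subset_eq) (simp_all add: index_position_less card_image[OF index_position_inj]
      image_subset_iff)
  then have "m \<in> index_position ` (UNIV :: 'n set)" using assms by simp
  then show ?thesis using that by auto
qed

lemma volume_form_eq: "length vs = CARD('n::{finite,linorder}) \<Longrightarrow> 
   (volume_form :: 'n form) vs = det (\<chi> i. vs ! index_position i)"
  by (simp add: volume_form_def index_position_def)

lemma volume_form_forms: "(volume_form :: 'n::{finite,linorder} form) \<in> exterior_forms CARD('n)"
  unfolding exterior_forms_def
proof (intro CollectI conjI allI impI; (elim conjE)?)
  fix vs :: "(real, 'n) vec list" assume "length vs \<noteq> CARD('n)"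
  then show "volume_form vs = 0" by (simp add: volume_form_def)
next
  fix vs :: "(real, 'n) vec list" and m assume vs: "length vs = CARD('n)" and m: "m < CARD('n)"
  obtain i :: 'n where i: "index_position i = m" using index_position_surj[OF m] .
  have *: "volume_form (vs[m := x]) = det (\<chi> j. if j = i then x else vs ! index_position j)" for x
  proof -
    have "(\<chi> j. vs[m := x] ! index_position j) = (\<chi> j. if j = i then x else vs ! index_position j)"
      using i m vs by (auto simp: vec_eq_iff nth_list_update injD[OF index_position_inj])
    then show ?thesis using vs by (simp add: volume_form_eq)
  qed
  show "linear (\<lambda>x. volume_form (vs[m := x]))"
    unfolding * linear_iff
  proof (intro conjI allI)
    fix x y :: "(real, 'n) vec" and c :: real
    let ?D = "\<lambda>x. det (\<chi> j. if j = i then x else vs ! index_position j)"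
    show "?D (x + y) = ?D x + ?D y" by (rule det_row_add)
    show "?D (c *\<^sub>R x) = c *\<^sub>R ?D x"
      unfolding scalar_mult_eq_scaleR[symmetric] real_scaleR_def by (rule det_row_mul)
  qed
next
  fix vs :: "(real, 'n) vec list" and l m
  assume vs: "length vs = CARD('n)" and lm: "l < m" "m < CARD('n)" "vs ! l = vs ! m"
  obtain i j :: 'n where ij: "index_position i = l" "index_position j = m"
    using index_position_surj lm order.strict_trans by metis
  show "volume_form vs = 0"
    unfolding volume_form_eq[OF vs]
    by (rule det_identical_rows[of i j]) (use lm ij in \<open>auto simp: row_def vec_eq_iff\<close>)
qed

text \<open>
  The matrix with these rows is orthogonal.
\<close>

lemma volume_form_basis:
  assumes "length L = CARD('n::{finite,linorder})" "distinct (L :: 'n list)"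
  shows "volume_form (basis_list L) * volume_form (basis_list L) = 1"
proof -
  let ?A = "(\<chi> i. axis (L ! index_position i) 1) :: ((real, 'n) vec, 'n) vec"
  have V: "volume_form (basis_list L) = det ?A"
    using assms(1) by (simp add: volume_form_eq basis_list_def index_position_less)
  have "orthogonal_matrix ?A"
    unfolding orthogonal_matrix_orthonormal_rows
  proof (intro conjI allI impI)
    show "norm (row i ?A) = 1" for i by (simp add: row_def)
    fix i j :: 'n assume "i \<noteq> j"
    then have "L ! index_position i \<noteq> L ! index_position j"
      using assms index_position_less injD[OF index_position_inj] by (metis nth_eq_iff_index_eq)
    then show "orthogonal (row i ?A) (row j ?A)"
      by (simp add: row_def orthogonal_def inner_axis_axis)
  qed
  then show ?thesis using det_orthogonal_matrix[of ?A] V by auto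
qed

text \<open>
  The only increasing list \<open>K\<close> that completes \<open>I\<close> to a basis is the complement of \<open>I\<close>. It
  completes another list \<open>M\<close> of the same length only if \<open>M = I\<close>.
\<close>

lemma volume_form_complement_orthogonality:
  assumes I: "I \<in> increasing_indices m" and M: "M \<in> increasing_indices m" and m: "m \<le> CARD('n)"
  shows "(\<Sum>K\<in>increasing_indices (CARD('n) - m). volume_form (basis_list (I @ K)) *
     volume_form (basis_list (M @ K))) = (if I = (M :: 'n::{finite,linorder} list) then 1 else 0)"
proof -
  let ?v = "\<lambda>L :: 'n list. volume_form (basis_list L)"
  have dI: "distinct I" "distinct M" "length I = m" "length M = m"
    using I M by (auto simp: increasing_distinct increasing_length)
  define C where "C = sorted_list_of_set (- set I)"
  have cC: "card (- set I) = CARD('n) - m"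
    using dI by (simp add: Compl_eq_Diff_UNIV card_Diff_subset distinct_card)
  then have C: "C \<in> increasing_indices (CARD('n) - m)"
    using sorted_list_increasing[of "- set I"] by (simp add: C_def)
  have z: "?v (I @ K) = 0" if K: "K \<in> increasing_indices (CARD('n) - m)" "K \<noteq> C" for K
  proof (rule forms_basis_not_distinct[OF volume_form_forms], rule notI)
    assume "distinct (I @ K)"
    then have "set K \<subseteq> - set I" by auto
    moreover have "card (set K) = card (- set I)"
      using cC K by (simp add: distinct_card increasing_distinct increasing_length)
    ultimately have "set K = - set I" by (intro card_subset_eq) auto
    then have "K = C" using K C
      by (intro strict_sorted_equal) (auto simp: increasing_indices_def C_def)
    then show False using K by simp
  qed
  have "(\<Sum>K\<in>increasing_indices (CARD('n) - m). ?v (I @ K) * ?v (M @ K))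
    = (\<Sum>K\<in>{C}. ?v (I @ K) * ?v (M @ K))"
    by (rule sum.mono_neutral_right) (use C z in auto)
  also have "\<dots> = (if I = M then 1 else 0)"
  proof (cases "I = M")
    case True
    have "distinct (I @ C)" "length (I @ C) = CARD('n)"
      using dI cC m by (auto simp: C_def)
    then show ?thesis using True volume_form_basis[of "I @ C"] by simp
  next
    case False
    then have "set I \<noteq> set M" using I M
      by (metis (mono_tags, lifting) increasing_indices_def mem_Collect_eq strict_sorted_equal)
    have "\<not> distinct (M @ C)"
    proof
      assume "distinct (M @ C)"
      then have "set M \<subseteq> set I" by (auto simp: C_def)
      then have "set M = set I" using dI by (intro card_subset_eq) (auto simp: distinct_card)
      then show False using \<open>set I \<noteq> set M\<close> by simp
    qed
    then show ?thesis using False forms_basis_not_distinct[OF volume_form_forms, of "M @ C"] by simp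
  qed
  finally show ?thesis .
qed

lemma hodge_star_linear:
  "hodge_star k (\<omega> + \<omega>') = hodge_star k \<omega> + hodge_star k \<omega>'"
  "hodge_star k (t \<cdot> \<omega>) = t \<cdot> hodge_star k \<omega>"
  "hodge_star k 0 = 0"
  by (simp_all add: hodge_star_eq_contract contract_linear)

lemma hodge_star_forms:
  assumes "m \<le> CARD('n)"
  shows "hodge_star m (\<omega> :: 'n::{finite,linorder} form) \<in> exterior_forms (CARD('n) - m)"
  unfolding hodge_star_eq_contract by (rule contract_forms) (use assms volume_form_forms in simp)

lemma hodge_star_hodge_star:
  assumes w: "\<omega> \<in> exterior_forms m" and m: "m \<le> CARD('n)"
  shows "hodge_star (CARD('n) - m) (hodge_star m \<omega>)
    = (-1) ^ (m * (CARD('n) - m)) \<cdot> (\<omega> :: 'n::{finite,linorder} form)"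
proof (rule forms_eqI[of _ m])
  let ?l = "CARD('n) - m"
  let ?v = "\<lambda>L :: 'n list. volume_form (basis_list L)"
  show "hodge_star ?l (hodge_star m \<omega>) \<in> exterior_forms m"
    using hodge_star_forms[of ?l "hodge_star m \<omega>"] m by simp
  fix M :: "'n list" assume M: "M \<in> increasing_indices m"
  have "hodge_star ?l (hodge_star m \<omega>) (basis_list M)
     = (\<Sum>K\<in>increasing_indices ?l. \<Sum>I\<in>increasing_indices m. \<omega> (basis_list I) *
       (?v (I @ K) * ?v (K @ M)))"
    by (simp add: hodge_star_def sum_distrib_right mult.assoc)
  also have "\<dots> = (\<Sum>K\<in>increasing_indices ?l. \<Sum>I\<in>increasing_indices m. (-1) ^ (m * ?l) *
    (\<omega> (basis_list I) * (?v (I @ K) * ?v (M @ K))))"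
  proof (intro sum.cong refl)
    fix K I :: "'n list" assume K: "K \<in> increasing_indices ?l"
    have "?v (K @ M) = (-1) ^ (m * ?l) * ?v (M @ K)"
      using forms_move_block[OF volume_form_forms, of "basis_list K" "basis_list M" "[]"] K M
      by (simp add: increasing_length mult.commute)
    then show "\<omega> (basis_list I) * (?v (I @ K) * ?v (K @ M))
      = (-1) ^ (m * ?l) * (\<omega> (basis_list I) * (?v (I @ K) * ?v (M @ K)))"
      by simp
  qed
  also have "\<dots> = (\<Sum>I\<in>increasing_indices m. \<Sum>K\<in>increasing_indices ?l. (-1) ^ (m * ?l) *
    (\<omega> (basis_list I) * (?v (I @ K) * ?v (M @ K))))"
    by (rule sum.swap)
  also have "\<dots> = (\<Sum>I\<in>increasing_indices m. (-1) ^ (m * ?l) * (\<omega> (basis_list I) * (if I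
    = M then 1 else 0)))"
  proof (rule sum.cong[OF refl])
    fix I :: "'n list" assume I: "I \<in> increasing_indices m"
    show "(\<Sum>K\<in>increasing_indices ?l. (-1) ^ (m * ?l) * (\<omega> (basis_list I) * (?v (I @ K) * ?v (M @ K))))
       = (-1) ^ (m * ?l) * (\<omega> (basis_list I) * (if I = M then 1 else 0))"
      by (simp only: volume_form_complement_orthogonality[OF I M m, symmetric] sum_distrib_left)
  qed
  also have "\<dots> = (\<Sum>I\<in>increasing_indices m. if I = M then (-1) ^ (m * ?l) * \<omega> (basis_list I) else 0)"
    by (intro sum.cong refl) simp
  also have "\<dots> = (-1) ^ (m * ?l) * \<omega> (basis_list M)"
    using M by simp
  finally show "hodge_star ?l (hodge_star m \<omega>) (basis_list M) = ((-1) ^ (m * ?l) \<cdot> \<omega>) (basis_list M)"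
    by simp
qed (use w in blast)

text \<open>
  Contraction of the volume form with \<open>\<gamma> \<and> a\<close> is contraction with \<open>\<gamma>\<close> and then with \<open>a\<close>; the
  sign comes from exchanging \<open>a\<close> and \<open>\<gamma>\<close>.
\<close>

lemma hodge_star_wedge_one:
  fixes a \<gamma> :: "'n::{finite,linorder} form"
  assumes a: "a \<in> exterior_forms 1" and g: "\<gamma> \<in> exterior_forms l" and l: "Suc l \<le> CARD('n)"
  shows "hodge_star (Suc l) (wedge 1 l a \<gamma>) = (-1) ^ l \<cdot> interior_product a (hodge_star l \<gamma>)"
proof -
  have v: "(volume_form :: 'n form) \<in> exterior_forms (l + 1 + (CARD('n) - Suc l))"
    using l volume_form_forms[where 'n = 'n] by simp
  have "hodge_star (Suc l) (wedge l 1 \<gamma> a) = contract 1 (hodge_star l \<gamma>) a"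
    using contract_wedge[OF v g a] by (simp add: hodge_star_eq_contract)
  also have "\<dots> = interior_product a (hodge_star l \<gamma>)"
    by (rule interior_product_eq_contract[of _ "CARD('n) - Suc l"])
      (use hodge_star_forms[of l \<gamma>] l in \<open>simp add: Suc_diff_Suc\<close>)
  finally have *: "interior_product a (hodge_star l \<gamma>) = (-1) ^ l \<cdot> hodge_star (Suc l) (wedge 1 l a \<gamma>)"
    by (simp add: wedge_one_commute[OF a g, simplified] hodge_star_linear)
  show ?thesis unfolding * by (simp flip: power_mult_distrib)
qed

text \<open>
  The previous identity for \<open>\<gamma> = \<star>b\<close>, to which the star is applied once more. Of the three signs
  that arise, only \<open>(-1)\<^sup>k\<close> survives.
\<close>

lemma hodge_star_interior_product:
  fixes a b :: "'n::{finite,linorder} form"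
  assumes a: "a \<in> exterior_forms 1" and b: "b \<in> exterior_forms (Suc k)" and k: "Suc k \<le> CARD('n)"
  shows "hodge_star k (interior_product a b)
    = (-1) ^ k \<cdot> wedge 1 (CARD('n) - Suc k) a (hodge_star (Suc k) b)"
proof -
  define l where "l = CARD('n) - Suc k"
  define g where "g = hodge_star (Suc k) b"
  have n: "CARD('n) = Suc k + l" using k by (simp add: l_def)
  have g: "g \<in> exterior_forms l" using hodge_star_forms[OF k, of b] by (simp add: g_def l_def)
  have w: "wedge 1 l a g \<in> exterior_forms (Suc l)" using wedge_forms[OF a g] by simp
  have "hodge_star l g = (-1) ^ (Suc k * l) \<cdot> b"
    using hodge_star_hodge_star[OF b k] by (simp add: g_def n)
  then have "interior_product a b = (-1) ^ (Suc k * l) \<cdot> interior_product a (hodge_star l g)"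
    by (simp add: interior_product_linear flip: power_mult_distrib)
  also have "\<dots> = ((-1) ^ (Suc k * l) * (-1) ^ l) \<cdot> hodge_star (Suc l) (wedge 1 l a g)"
    using hodge_star_wedge_one[OF a g] n by (simp add: mult.assoc flip: power_mult_distrib)
  finally have "hodge_star k (interior_product a b)
      = ((-1) ^ (Suc k * l) * (-1) ^ l) \<cdot> hodge_star k (hodge_star (Suc l) (wedge 1 l a g))"
    by (simp add: hodge_star_linear)
  also have "hodge_star k (hodge_star (Suc l) (wedge 1 l a g)) = (-1) ^ (Suc l * k) \<cdot> wedge 1 l a g"
    using hodge_star_hodge_star[OF w] n by simp
  also have "((-1) ^ (Suc k * l) * (-1) ^ l) \<cdot> (-1) ^ (Suc l * k) \<cdot> wedge 1 l a g
    = (-1) ^ k \<cdot> wedge 1 l a g"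
    by (simp add: power_add mult.commute[of l k] minus_one_power_iff)
  finally show ?thesis by (simp add: g_def l_def)
qed

section \<open>Finite differences of functions that are affine along decomposable directions\<close>

text \<open>
  Below, forms are mostly points of a vector space. Inductions leave them eta-expanded, and the
  pointwise rules would then unfold sums and multiples of forms.
\<close>

lemmas form_apply = plus_fun_apply zero_fun_apply scale_form_apply
declare form_apply [simp del]

lemma scale_form_sum: "t \<cdot> (\<Sum>i\<in>A. g i) = (\<Sum>i\<in>A. t \<cdot> g i)"
  by (simp add: fun_eq_iff sum_fun_apply form_apply sum_distrib_left)

text \<open>
  Only directions \<open>a \<and> \<beta>\<close> with a covector \<open>a\<close> are tested. For fixed \<open>a\<close> they form a linear
  space, on whose translates the function is therefore affine.
\<close>

definition ext_one_affine :: "nat \<Rightarrow> (('n::{finite,linorder}) form \<Rightarrow> real) \<Rightarrow> bool"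
  where "ext_one_affine k G \<longleftrightarrow>
    (\<forall>\<xi>\<in>exterior_forms (Suc k). \<forall>a\<in>exterior_forms 1. \<forall>\<beta>\<in>exterior_forms k. \<forall>t.
       G (\<xi> + t \<cdot> wedge 1 k a \<beta>) = G \<xi> + t * (G (\<xi> + wedge 1 k a \<beta>) - G \<xi>))"

definition forward_difference :: "'n form \<Rightarrow> ('n form \<Rightarrow> real) \<Rightarrow> 'n form \<Rightarrow> real"
  where "forward_difference h G \<xi> = G (\<xi> + h) - G \<xi>"

lemma ext_one_affineD:
  assumes "ext_one_affine k G" "\<xi> \<in> exterior_forms (Suc k)" "a \<in> exterior_forms 1" "\<beta> \<in>
    exterior_forms k"
  shows "G (\<xi> + t \<cdot> wedge 1 k a \<beta>) = G \<xi> + t * forward_difference (wedge 1 k a \<beta>) G \<xi>"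
  using assms unfolding ext_one_affine_def forward_difference_def by blast

lemma wedge_one_forms:
  "a \<in> exterior_forms 1 \<Longrightarrow> \<beta> \<in> exterior_forms k \<Longrightarrow> wedge 1 k a \<beta> \<in> exterior_forms (Suc k)"
  using wedge_forms[of a 1 \<beta> k] by simp

lemma ext_one_affine_translate:
  assumes "ext_one_affine k G" "h \<in> exterior_forms (Suc k)"
  shows "ext_one_affine k (\<lambda>\<xi>. G (h + \<xi>))"
  unfolding ext_one_affine_def
  using ext_one_affineD[OF assms(1) forms_add[OF assms(2)]]
  by (simp add: forward_difference_def add.assoc)

lemma ext_one_affine_difference:
  assumes "ext_one_affine k G" "h \<in> exterior_forms (Suc k)"
  shows "ext_one_affine k (forward_difference h G)"
  unfolding ext_one_affine_def
proof (intro ballI allI)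
  fix \<xi> a \<beta> :: "'a form" and t
  assume x: "\<xi> \<in> exterior_forms (Suc k)" and ab: "a \<in> exterior_forms 1" "\<beta> \<in> exterior_forms k"
  let ?w = "wedge 1 k a \<beta>" and ?D = "forward_difference h G"
  have D: "?D \<zeta> = G (h + \<zeta>) - G \<zeta>" for \<zeta> by (simp add: forward_difference_def add.commute)
  show "?D (\<xi> + t \<cdot> ?w) = ?D \<xi> + t * (?D (\<xi> + ?w) - ?D \<xi>)"
    unfolding D using ext_one_affineD[OF assms(1) x ab, of t]
      ext_one_affineD[OF ext_one_affine_translate[OF assms] x ab, of t]
    unfolding forward_difference_def by (simp add: algebra_simps)
qed

lemma forward_difference_commute:
  "forward_difference h (forward_difference h' G) = forward_difference h' (forward_difference h G)"
  by (simp add: fun_eq_iff forward_difference_def add_ac)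

text \<open>
  The point \<open>\<xi> + u + v\<close> is the midpoint of \<open>\<xi> + 2 u\<close> and \<open>\<xi> + 2 v\<close>, and for \<open>u = a \<and> \<beta>\<close> and
  \<open>v = a \<and> \<gamma>\<close> the segment between these has the admissible direction \<open>a \<and> (2 \<gamma> - 2 \<beta>)\<close>.
\<close>

lemma forward_difference_additive:
  fixes G :: "'n::{finite,linorder} form \<Rightarrow> real"
  assumes G: "ext_one_affine k G" and x: "\<xi> \<in> exterior_forms (Suc k)" and a: "a \<in> exterior_forms 1"
    and b: "\<beta> \<in> exterior_forms k" "\<gamma> \<in> exterior_forms k"
  shows "forward_difference (wedge 1 k a \<beta> + wedge 1 k a \<gamma>) G \<xi>
       = forward_difference (wedge 1 k a \<beta>) G \<xi> + forward_difference (wedge 1 k a \<gamma>) G \<xi>"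
proof -
  let ?u = "wedge 1 k a \<beta>" and ?v = "wedge 1 k a \<gamma>"
  have x2: "\<xi> + 2 \<cdot> ?u \<in> exterior_forms (Suc k)"
    using x wedge_one_forms[OF a b(1)] by blast
  have d: "2 \<cdot> \<gamma> + (-2) \<cdot> \<beta> \<in> exterior_forms k" using b by blast
  have w: "wedge 1 k a (2 \<cdot> \<gamma> + (-2) \<cdot> \<beta>) = 2 \<cdot> ?v + (-2) \<cdot> ?u"
    by (simp only: wedge_linear)
  have e: "\<xi> + 2 \<cdot> ?u + (1/2) \<cdot> (2 \<cdot> ?v + (-2) \<cdot> ?u) = \<xi> + (?u + ?v)"
    "\<xi> + 2 \<cdot> ?u + (2 \<cdot> ?v + (-2) \<cdot> ?u) = \<xi> + 2 \<cdot> ?v"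
    by (simp_all add: fun_eq_iff form_apply algebra_simps)
  have "G (\<xi> + (?u + ?v)) = G (\<xi> + 2 \<cdot> ?u) + (1/2) * (G (\<xi> + 2 \<cdot> ?v) - G (\<xi> + 2 \<cdot> ?u))"
    using ext_one_affineD[OF G x2 a d, of "1/2"] unfolding w forward_difference_def e .
  moreover have "y - g = (p - g) + (q - g)"
    if "y = p' + (1/2) * (q' - p')" "p' = g + 2 * (p - g)" "q' = g + 2 * (q - g)"
      for y g p q p' q' :: real
    using that by (simp add: field_simps)
  ultimately show ?thesis
    using ext_one_affineD[OF G x a b(1), of 2] ext_one_affineD[OF G x a b(2), of 2]
    unfolding forward_difference_def by blast
qed

lemma second_difference_zero:
  assumes G: "ext_one_affine k G" and x: "\<xi> \<in> exterior_forms (Suc k)" and a: "a \<in> exterior_forms 1"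
    and b: "\<beta> \<in> exterior_forms k" "\<gamma> \<in> exterior_forms k"
  shows "forward_difference (wedge 1 k a \<beta>) (forward_difference (wedge 1 k a \<gamma>) G) \<xi> = 0"
  using forward_difference_additive[OF assms] by (simp add: forward_difference_def add.assoc)

text \<open>
  The \<open>s\<close>-th mixed difference at 0 whose increments are the decomposable forms of the \<open>s\<close>
  consecutive blocks of \<open>p\<close> vectors of the argument list.
\<close>

primrec mixed_difference :: "nat \<Rightarrow> nat \<Rightarrow> (('n::{finite,linorder}) form \<Rightarrow> real) \<Rightarrow> 'n form"
  where
    "mixed_difference p 0 = (\<lambda>G. G 0 \<cdot> unit_form)"
  | "mixed_difference p (Suc s) = (\<lambda>G vs. if length vs = p * Suc s
       then mixed_difference p s (forward_difference (decomposable (take p vs)) G) (drop p vs) else 0)"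

lemma mixed_difference_length: "length vs \<noteq> p * s \<Longrightarrow> mixed_difference p s G vs = 0"
  by (cases s) (auto simp: unit_form_def form_apply)

lemma mixed_difference_append:
  assumes "length us = p"
  shows "mixed_difference p (Suc s) G (us @ vs)
    = mixed_difference p s (forward_difference (decomposable us) G) vs"
  using assms mixed_difference_length[of vs p s] by auto

lemma mixed_difference_cong:
  assumes "\<And>\<xi>. \<xi> \<in> exterior_forms p \<Longrightarrow> G \<xi> = G' \<xi>"
  shows "mixed_difference p s G vs = mixed_difference p s G' vs"
  using assms
proof (induction s arbitrary: G G' vs)
  case (Suc s)
  have "forward_difference (decomposable (take p vs)) G \<xi>
    = forward_difference (decomposable (take p vs)) G' \<xi>"
    if "length vs = p * Suc s" "\<xi> \<in> exterior_forms p" for \<xi>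
  proof -
    have "decomposable (take p vs) \<in> exterior_forms p" by (rule decomposable_forms') (use that in simp)
    with that have "\<xi> + decomposable (take p vs) \<in> exterior_forms p" by blast
    then show ?thesis using that Suc.prems by (simp add: forward_difference_def)
  qed
  then show ?case
    using Suc.IH[of "forward_difference (decomposable (take p vs)) G" "forward_difference
      (decomposable (take p vs)) G'"]
    by simp
qed simp

lemma forward_difference_linear:
  "forward_difference h (\<lambda>\<xi>. G \<xi> + G' \<xi>) = (\<lambda>\<xi>. forward_difference h G \<xi> + forward_difference h G' \<xi>)"
  "forward_difference h (\<lambda>\<xi>. t * G \<xi>) = (\<lambda>\<xi>. t * forward_difference h G \<xi>)"
  by (auto simp: fun_eq_iff forward_difference_def algebra_simps)

lemma mixed_difference_linear:
  "mixed_difference p s (\<lambda>\<xi>. G \<xi> + G' \<xi>) vs = mixed_difference p s G vs + mixed_difference p s G' vs"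
  "mixed_difference p s (\<lambda>\<xi>. t * G \<xi>) vs = t * mixed_difference p s G vs"
proof (induction s arbitrary: G G' vs)
  case (Suc s)
  { case 1 show ?case by (simp add: forward_difference_linear Suc.IH) }
  { case 2 show ?case by (simp add: forward_difference_linear Suc.IH) }
qed (auto simp: form_apply algebra_simps)

lemma mixed_difference_zero:
  assumes "\<And>\<xi>. \<xi> \<in> exterior_forms p \<Longrightarrow> G \<xi> = 0"
  shows "mixed_difference p s G vs = 0"
  using mixed_difference_cong[of p G "\<lambda>_. 0 * 0", OF _]
    mixed_difference_linear(2)[of p s 0 "\<lambda>_. 0" vs] assms
  by simp

text \<open>
  Differences commute, so an increment divisible by \<open>x\<close> that occurs late in the list annihilates
  \<open>G\<close> at once.
\<close>

lemma mixed_difference_vanish: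
  assumes "\<And>\<gamma> \<xi>. \<gamma> \<in> exterior_forms k \<Longrightarrow> \<xi> \<in> exterior_forms (Suc k) \<Longrightarrow>
      forward_difference (wedge 1 k (one_form x) \<gamma>) G \<xi> = 0"
    and "x \<in> set vs"
  shows "mixed_difference (Suc k) s G vs = 0"
  using assms
proof (induction s arbitrary: G vs)
  case 0
  then show ?case by (auto simp: unit_form_def form_apply)
next
  case (Suc s)
  show ?case
  proof (cases "length vs = Suc k * Suc s")
    case len: True
    define us ws where "us = take (Suc k) vs" and "ws = drop (Suc k) vs"
    have us: "length us = Suc k" using len by (simp add: us_def)
    have vs: "vs = us @ ws" by (simp add: us_def ws_def)
    have dus: "decomposable us \<in> exterior_forms (Suc k)" by (rule decomposable_forms'[OF us])
    show ?thesis
    proof (cases "x \<in> set us")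
      case True
      then obtain \<gamma> where "\<gamma> \<in> exterior_forms k" "decomposable us = wedge 1 k (one_form x) \<gamma>"
        using decomposable_divisible[of x us] us by auto
      then show ?thesis unfolding vs mixed_difference_append[OF us]
        using Suc.prems(1) by (intro mixed_difference_zero) simp
    next
      case False
      then have "x \<in> set ws" using Suc.prems(2) vs by auto
      moreover have "forward_difference (wedge 1 k (one_form x) \<gamma>)
        (forward_difference (decomposable us) G) \<xi> = 0"
        if "\<gamma> \<in> exterior_forms k" "\<xi> \<in> exterior_forms (Suc k)" for \<gamma> \<xi>
        unfolding forward_difference_commute[of "wedge 1 k (one_form x) \<gamma>"]
        using Suc.prems(1)[OF that(1) forms_add[OF that(2) dus]] Suc.prems(1)[OF that]
        by (subst forward_difference_def) simp
      ultimately show ?thesis unfolding vs mixed_difference_append[OF us] by (intro Suc.IH)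
    qed
  qed (rule mixed_difference_length)
qed

text \<open>
  This is where alternation comes from. A vector repeated within one block makes the increment
  zero. A vector \<open>x\<close> repeated in two blocks gives two increments \<open>x \<and> \<gamma>\<close> and \<open>x \<and> \<delta>\<close>, along
  whose plane \<open>G\<close> is affine. For linearity in one vector, any other vector of the same block is
  a common factor of all increments involved; the block has at least two vectors because
  \<open>k \<ge> 1\<close>.
\<close>

lemma mixed_difference_forms:
  fixes G :: "'n::{finite,linorder} form \<Rightarrow> real"
  assumes k: "1 \<le> k" and G: "ext_one_affine k G"
  shows "mixed_difference (Suc k) s G \<in> exterior_forms (Suc k * s)"
  using G
proof (induction s arbitrary: G)
  case 0
  then show ?case by (simp add: forms_scale)
next
  case (Suc s)
  let ?p = "Suc k" and ?D = "\<lambda>us. forward_difference (decomposable us) G"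
  have IH: "mixed_difference ?p s (?D us) \<in> exterior_forms (?p * s)" if "length us = ?p" for us
    using that Suc.prems by (intro Suc.IH ext_one_affine_difference decomposable_forms') auto
  have md: "mixed_difference ?p (Suc s) G vs = mixed_difference ?p s (?D (take ?p vs)) (drop ?p vs)"
    if "length vs = ?p * Suc s" for vs using that by simp
  show ?case
    unfolding exterior_forms_def
  proof (intro CollectI conjI allI impI; (elim conjE)?)
    fix vs :: "(real, 'n) vec list" assume "length vs \<noteq> ?p * Suc s"
    then show "mixed_difference ?p (Suc s) G vs = 0" by (rule mixed_difference_length)
  next
    fix vs :: "(real, 'n) vec list" and i assume vs: "length vs = ?p * Suc s" and i: "i < ?p * Suc s"
    define us ws where "us = take ?p vs" and "ws = drop ?p vs"
    have us: "length us = ?p" and ws: "length ws = ?p * s" using vs by (auto simp: us_def ws_def)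
    have up: "mixed_difference ?p (Suc s) G (vs[i := x])
      = mixed_difference ?p s (?D (take ?p (vs[i := x]))) (drop ?p (vs[i := x]))" for x
      by (rule md) (use vs in simp)
    show "linear (\<lambda>x. mixed_difference ?p (Suc s) G (vs[i := x]))"
    proof (cases "i < ?p")
      case True
      have up': "mixed_difference ?p (Suc s) G (vs[i := x])
        = mixed_difference ?p s (?D (us[i := x])) ws" for x
        using up[of x] True by (simp add: us_def ws_def take_update_swap)
      \<comment> \<open>another position in the same block, whose vector stays fixed while \<open>x\<close> varies\<close>
      define j where "j = (if i = 0 then 1 else 0 :: nat)"
      have j: "j < ?p" "j \<noteq> i" using k by (auto simp: j_def)
      have dv: "\<exists>\<gamma>\<in>exterior_forms k. decomposable (us[i := x]) = wedge 1 k (one_form (us ! j)) \<gamma>" for x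
      proof -
        have "us ! j \<in> set (us[i := x])"
          using j us by (metis length_list_update nth_list_update_neq nth_mem)
        then show ?thesis using decomposable_divisible[of "us ! j" "us[i := x]"] us by auto
      qed
      have "?D (us[i := x + y]) \<xi> = ?D (us[i := x]) \<xi> + ?D (us[i := y]) \<xi>"
        if "\<xi> \<in> exterior_forms ?p" for x y \<xi>
        using dv[of x] dv[of y] forward_difference_additive[OF Suc.prems that one_form_forms] True us
        by (auto simp: decomposable_update_add)
      moreover have "?D (us[i := t *\<^sub>R x]) \<xi> = t * ?D (us[i := x]) \<xi>"
        if "\<xi> \<in> exterior_forms ?p" for t x \<xi>
        using dv[of x] ext_one_affineD[OF Suc.prems that one_form_forms, of _ t] True us
        by (auto simp: decomposable_update_scale forward_difference_def[of "t \<cdot> _"])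
      ultimately show ?thesis
        unfolding up' linear_iff
        using mixed_difference_cong[of ?p "?D (us[i := _ + _])" "\<lambda>\<xi>. ?D (us[i := _]) \<xi>
          + ?D (us[i := _]) \<xi>" s ws]
          mixed_difference_cong[of ?p "?D (us[i := _ *\<^sub>R _])" "\<lambda>\<xi>. _ * ?D (us[i := _]) \<xi>" s ws]
        by (simp add: mixed_difference_linear)
    next
      case False
      have "mixed_difference ?p (Suc s) G (vs[i := x])
        = mixed_difference ?p s (?D us) (ws[i - ?p := x])" for x
        using up[of x] False by (simp add: us_def ws_def drop_update_swap del: mixed_difference.simps)
      moreover have "linear (\<lambda>x. mixed_difference ?p s (?D us) (ws[i - ?p := x]))"
        by (rule forms_linear[OF IH[OF us] ws]) (use i False in auto)
      ultimately show ?thesis by simp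
    qed
  next
    fix vs :: "(real, 'n) vec list" and i j
    assume vs: "length vs = ?p * Suc s" and ij: "i < j" "j < ?p * Suc s" and eq: "vs ! i = vs ! j"
    define us ws where "us = take ?p vs" and "ws = drop ?p vs"
    have us: "length us = ?p" and ws: "length ws = ?p * s" using vs by (auto simp: us_def ws_def)
    have nth: "us ! l = vs ! l" if "l < ?p" for l using that by (simp add: us_def)
    have nth': "ws ! (l - ?p) = vs ! l" "l - ?p < length ws" if "?p \<le> l" "l < ?p * Suc s" for l
      using that vs ws by (auto simp: ws_def)
    have "mixed_difference ?p s (?D us) ws = 0"
    proof -
      consider "j < ?p" | "?p \<le> i" | "i < ?p" "?p \<le> j" by linarith
      then show ?thesis
      proof cases
        case 1
        then have "\<not> distinct us"
          using ij eq us nth[of i] nth[of j]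
            by (metis nth_eq_iff_index_eq order.strict_trans nat_less_le)
        then show ?thesis
          by (intro mixed_difference_zero) (simp add: decomposable_repeat forward_difference_def)
      next
        case 2
        then show ?thesis
          using nth'[of i] nth'[of j] ij eq by (intro
            forms_repeat[OF IH[OF us], of "i - ?p" _ "j - ?p"]) auto
      next
        case 3
        then have "vs ! i \<in> set us" "vs ! i \<in> set ws"
          using nth[of i] nth'[of j] ij eq us by (metis nth_mem)+
        moreover obtain \<gamma> where "\<gamma> \<in> exterior_forms k" "decomposable us
          = wedge 1 k (one_form (vs ! i)) \<gamma>"
          using decomposable_divisible[OF calculation(1)] us by auto
        ultimately show ?thesis
          using second_difference_zero[OF Suc.prems _ one_form_forms]
          by (intro mixed_difference_vanish[of _ "vs ! i"]) auto
      qed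
    qed
    then show "mixed_difference ?p (Suc s) G vs = 0" using md[OF vs] by (simp add: us_def ws_def)
  qed
qed

section \<open>Pairing with exterior powers and the Taylor expansion\<close>

lemma wedge_power_forms: "\<xi> \<in> exterior_forms p \<Longrightarrow> wedge_power p \<xi> s \<in> exterior_forms (p * s)"
  by (induction s) (auto intro: wedge_forms)

text \<open>
  The functions \<open>\<xi> \<mapsto> \<langle>c; \<xi>\<^sup>s\<rangle>\<close> of which the representation is built.
\<close>

definition power_pairing :: "nat \<Rightarrow> nat \<Rightarrow> ('n::{finite,linorder}) form \<Rightarrow> 'n form \<Rightarrow> real"
  where "power_pairing p s c \<xi> = form_inner (p * s) c (wedge_power p \<xi> s)"

lemma power_pairing_0: "power_pairing p 0 c \<xi> = c []"
  by (simp add: power_pairing_def form_inner_eq_contract contract_0 unit_form_def form_apply)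

lemma power_pairing_linear:
  "power_pairing p s (c + c') \<xi> = power_pairing p s c \<xi> + power_pairing p s c' \<xi>"
  "power_pairing p s (t \<cdot> c) \<xi> = t * power_pairing p s c \<xi>"
  "power_pairing p s 0 \<xi> = 0"
  by (simp_all add: power_pairing_def form_inner_eq_contract contract_linear form_apply)

lemma power_pairing_sum:
  "power_pairing p s (\<Sum>i\<in>A. c i) \<xi> = (\<Sum>i\<in>A. power_pairing p s (c i) \<xi>)"
  by (simp add: power_pairing_def form_inner_def sum_fun_apply sum_distrib_right) (rule sum.swap)

text \<open>
  Removing one factor from the power by adjointness; all inductions on the exponent go through
  this recursion.
\<close>

lemma power_pairing_Suc:
  assumes "c \<in> exterior_forms (p * Suc s)" "\<xi> \<in> exterior_forms p"
  shows "power_pairing p (Suc s) c \<xi> = power_pairing p s (contract p c \<xi>) \<xi>"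
  using contract_wedge[of c p "p * s" 0 \<xi> "wedge_power p \<xi> s"] assms wedge_power_forms[of \<xi> p s]
  by (simp add: power_pairing_def form_inner_eq_contract)

text \<open>
  In each basis direction \<open>G\<close> is affine, so its partial derivatives are its forward differences.
  Adding one basis direction at a time turns this into the chain rule for the ray.
\<close>

lemma derivative_along_ray:
  fixes G :: "'n::{finite,linorder} form \<Rightarrow> real" and y :: "'n list \<Rightarrow> real"
  assumes "finite A" "A \<subseteq> increasing_indices (Suc k)" "ext_one_affine k G"
  defines "E \<equiv> \<lambda>I. decomposable (basis_list I)"
  shows "((\<lambda>t. G (\<Sum>I\<in>A. (t * y I) \<cdot> E I)) has_real_derivative
           (\<Sum>I\<in>A. y I * forward_difference (E I) G (\<Sum>I\<in>A. (t * y I) \<cdot> E I))) (at t)"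
  using assms(1-3)
proof (induction A arbitrary: G rule: finite_induct)
  case empty
  then show ?case by simp
next
  case (insert J A)
  define x where "x t = (\<Sum>I\<in>A. (t * y I) \<cdot> E I)" for t
  have E: "E I \<in> exterior_forms (Suc k)" if "I \<in> insert J A" for I
    unfolding E_def by (rule decomposable_forms')
      (use insert.prems(1) that in \<open>auto simp: increasing_length\<close>)
  have x: "x t \<in> exterior_forms (Suc k)" for t using E by (auto simp: x_def)
  have J: "length J = Suc k" using insert.prems(1) increasing_length by auto
  then obtain i J' where J': "J = i # J'" "length J' = k" by (cases J) auto
  define \<gamma> where "\<gamma> = decomposable (basis_list J')"
  have EJ: "E J = wedge 1 k (one_form (axis i 1)) \<gamma>" and g: "\<gamma> \<in> exterior_forms k"
    using J' decomposable_forms'[of "basis_list J'" k] by (auto simp: E_def \<gamma>_def)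
  have lin: "H (x t + r \<cdot> E J) = H (x t) + r * forward_difference (E J) H (x t)"
    if "ext_one_affine k H" for H t r
    unfolding EJ by (rule ext_one_affineD[OF that x one_form_forms g])
  have ins: "(\<Sum>I\<in>insert J A. (t * y I) \<cdot> E I) = x t + (t * y J) \<cdot> E J" for t
    using insert.hyps by (simp add: x_def add.commute)
  let ?D = "\<lambda>I. forward_difference (E I) G"
  have aff: "ext_one_affine k (?D I)" if "I \<in> insert J A" for I
    by (rule ext_one_affine_difference[OF insert.prems(2) E[OF that]])
  have d1: "((\<lambda>t. G (x t)) has_real_derivative (\<Sum>I\<in>A. y I * ?D I (x t))) (at t)"
    unfolding x_def by (rule insert.IH) (use insert.prems in auto)
  have d2: "((\<lambda>t. ?D J (x t)) has_real_derivative
    (\<Sum>I\<in>A. y I * forward_difference (E I) (?D J) (x t))) (at t)"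
    unfolding x_def by (rule insert.IH) (use insert.prems aff in auto)
  have d3: "((\<lambda>t. t * y J) has_real_derivative y J) (at t)"
    by (auto intro!: derivative_eq_intros)
  have "((\<lambda>t. G (x t) + (t * y J) * ?D J (x t)) has_real_derivative
      (\<Sum>I\<in>A. y I * ?D I (x t)) + (y J * ?D J (x t) + (\<Sum>I\<in>A. y I *
        forward_difference (E I) (?D J) (x t)) * (t * y J))) (at t)"
    by (rule DERIV_add[OF d1 DERIV_mult[OF d3 d2]])
  moreover have "(\<Sum>I\<in>A. y I * ?D I (x t)) + (y J * ?D J (x t)
    + (\<Sum>I\<in>A. y I * forward_difference (E I) (?D J) (x t)) * (t * y J))
      = (\<Sum>I\<in>insert J A. y I * ?D I (x t + (t * y J) \<cdot> E J))"
  proof -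
    have "forward_difference (E J) (?D J) (x t) = 0"
      unfolding EJ by (rule second_difference_zero[OF insert.prems(2) x one_form_forms g g])
    then have "?D J (x t + (t * y J) \<cdot> E J) = ?D J (x t)"
      using lin[OF aff, of J] by simp
    moreover have "?D I (x t + (t * y J) \<cdot> E J) = ?D I (x t)
      + (t * y J) * forward_difference (E I) (?D J) (x t)"
      if "I \<in> A" for I
      using lin[OF aff, of I] that by (simp add: forward_difference_commute[of "E J"])
    ultimately show ?thesis
      using insert.hyps by (simp add: sum.distrib sum_distrib_left sum_distrib_right algebra_simps)
  qed
  ultimately show ?case unfolding ins lin[OF insert.prems(2)] by simp
qed

text \<open>
  Induction on the order \<open>N\<close> from which on all mixed differences vanish. The derivative of
  \<open>t \<mapsto> G (t \<xi>)\<close> is a combination of first differences of \<open>G\<close>, for which this order is smaller.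
  By the recursions for mixed differences and for pairings, which both split off the first
  block, their expansions add up to the derivative of the asserted sum.
\<close>

lemma taylor_expansion:
  fixes G :: "'n::{finite,linorder} form \<Rightarrow> real"
  assumes k: "1 \<le> k" and x: "\<xi> \<in> exterior_forms (Suc k)"
    and "ext_one_affine k G"
    and "\<And>x vs. x \<in> exterior_forms (Suc k) \<Longrightarrow> mixed_difference (Suc k) N (\<lambda>\<xi>. G (x + \<xi>)) vs = 0"
  shows "G (t \<cdot> \<xi>) = (\<Sum>s<N. t ^ s / fact s * power_pairing (Suc k) s (mixed_difference (Suc k) s G) \<xi>)"
  using assms(3,4)
proof (induction N arbitrary: G t)
  case 0
  then show ?case using 0(2)[OF forms_scale[OF x, of t], of "[]"] by (simp add: unit_form_def
    form_apply)
next
  case (Suc N)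
  note G = Suc.prems(1)
  let ?p = "Suc k" and ?E = "\<lambda>I :: 'n list. decomposable (basis_list I)" and ?y = "\<lambda>I. \<xi> (basis_list I)"
  let ?D = "\<lambda>I. forward_difference (?E I) G"
  define P where "P s = power_pairing ?p s (mixed_difference ?p s G) \<xi>" for s
  have E: "?E I \<in> exterior_forms ?p" "length (basis_list I) = ?p" if "I \<in> increasing_indices ?p" for I
    using that by (auto intro!: decomposable_forms' simp: increasing_length)
  have tx: "(\<Sum>I\<in>increasing_indices ?p. (t * ?y I) \<cdot> ?E I) = t \<cdot> \<xi>" for t
    by (rule sym, subst form_expansion[OF x]) (simp add: scale_form_sum)
  have IH: "?D I (t \<cdot> \<xi>) = (\<Sum>s<N. t ^ s / fact s * power_pairing ?p s (mixed_difference ?p s (?D I)) \<xi>)"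
    if I: "I \<in> increasing_indices ?p" for I t
  proof (rule Suc.IH)
    show "ext_one_affine k (?D I)" by (rule ext_one_affine_difference[OF G E(1)[OF I]])
    fix x :: "'n form" and vs assume x: "x \<in> exterior_forms ?p"
    have "(\<lambda>\<xi>. ?D I (x + \<xi>)) = forward_difference (?E I) (\<lambda>\<xi>. G (x + \<xi>))"
      by (simp add: fun_eq_iff forward_difference_def add.assoc)
    then show "mixed_difference ?p N (\<lambda>\<xi>. ?D I (x + \<xi>)) vs = 0"
      using Suc.prems(2)[OF x, of "basis_list I @ vs"] mixed_difference_append[OF E(2)[OF I]] by simp
  qed
  have rec: "(\<Sum>I\<in>increasing_indices ?p. ?y I * power_pairing ?p s (mixed_difference ?p s (?D I)) \<xi>)
    = P (Suc s)" for s
  proof -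
    have "contract ?p (mixed_difference ?p (Suc s) G) \<xi>
      = (\<Sum>I\<in>increasing_indices ?p. ?y I \<cdot> mixed_difference ?p s (?D I))"
      unfolding fun_eq_iff contract_def sum_fun_apply scale_form_apply
      by (intro allI sum.cong refl) (simp add: mixed_difference_append[OF E(2)] del:
        mixed_difference.simps)
    then show ?thesis
      using power_pairing_Suc[OF mixed_difference_forms[OF k G] x]
      by (simp add: P_def power_pairing_sum power_pairing_linear del: mixed_difference.simps)
  qed
  let ?h = "\<lambda>t. \<Sum>s<Suc N. t ^ s / fact s * P s"
  have "((\<lambda>t. G (t \<cdot> \<xi>)) has_real_derivative (\<Sum>s<N. t ^ s / fact s * P (Suc s))) (at t)" for t
  proof -
    have "((\<lambda>t. G (t \<cdot> \<xi>)) has_real_derivative (\<Sum>I\<in>increasing_indices ?p. ?y I * ?D I (t \<cdot> \<xi>))) (at t)"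
      using derivative_along_ray[OF finite_increasing order_refl G, of ?y t] by (simp add: tx)
    also have "(\<Sum>I\<in>increasing_indices ?p. ?y I * ?D I (t \<cdot> \<xi>))
       = (\<Sum>I\<in>increasing_indices ?p. \<Sum>s<N. t ^ s / fact s *
         (?y I * power_pairing ?p s (mixed_difference ?p s (?D I)) \<xi>))"
      by (intro sum.cong refl) (simp add: IH sum_distrib_left mult_ac)
    also have "\<dots> = (\<Sum>s<N. t ^ s / fact s * P (Suc s))"
      by (subst sum.swap) (simp only: rec flip: sum_distrib_left)
    finally show ?thesis .
  qed
  moreover have "(?h has_real_derivative (\<Sum>s<N. t ^ s / fact s * P (Suc s))) (at t)" for t
  proof -
    have "((\<lambda>t. t ^ Suc s / fact (Suc s) * P (Suc s))
      has_real_derivative t ^ s / fact s * P (Suc s)) (at t)" for s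
      by (rule derivative_eq_intros refl | simp add: field_simps del: of_nat_Suc)+
    then have "((\<lambda>t. P 0 + (\<Sum>s<N. t ^ Suc s / fact (Suc s) * P (Suc s))) has_real_derivative
        0 + (\<Sum>s<N. t ^ s / fact s * P (Suc s))) (at t)"
      by (intro DERIV_add DERIV_const DERIV_sum)
    then show ?thesis by (subst sum.lessThan_Suc_shift) simp
  qed
  ultimately have "((\<lambda>t. G (t \<cdot> \<xi>) - ?h t) has_real_derivative 0) (at t)" for t
    using DERIV_diff by fastforce
  then have "G (t \<cdot> \<xi>) - ?h t = G (0 \<cdot> \<xi>) - ?h 0" by (intro DERIV_isconst_all) blast
  also have "?h 0 = G 0"
    by (subst sum.lessThan_Suc_shift) (simp add: P_def power_pairing_0 unit_form_def form_apply)
  finally show ?case by (simp add: P_def)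
qed

text \<open>
  Mixed differences of an order \<open>s\<close> with \<open>(k + 1) s > n\<close> are alternating forms of degree larger
  than \<open>n\<close> and vanish, at whatever point they are taken. So the Taylor expansion stops, and at
  \<open>t = 1\<close> it gives the representation.
\<close>

lemma ext_one_affine_representation:
  fixes G :: "'n::{finite,linorder} form \<Rightarrow> real"
  assumes k: "1 \<le> k" and G: "ext_one_affine k G"
  obtains c :: "nat \<Rightarrow> 'n form" where "\<And>s. c s \<in> exterior_forms (Suc k * s)"
    "\<And>\<xi>. \<xi> \<in> exterior_forms (Suc k) \<Longrightarrow> G \<xi> = (\<Sum>s
      = 0..CARD('n) div Suc k. power_pairing (Suc k) s (c s) \<xi>)"
proof
  let ?N = "CARD('n) div Suc k"
  let ?c = "\<lambda>s. (1 / fact s) \<cdot> mixed_difference (Suc k) s G"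
  show "?c s \<in> exterior_forms (Suc k * s)" for s
    by (intro forms_scale mixed_difference_forms assms)
  fix \<xi> :: "'n form" assume x: "\<xi> \<in> exterior_forms (Suc k)"
  have big: "Suc k * Suc ?N > CARD('n)"
    using dividend_less_times_div[of "Suc k" "CARD('n)"] by simp
  have "mixed_difference (Suc k) (Suc ?N) (\<lambda>\<xi>. G (x + \<xi>)) vs = 0" if "x \<in> exterior_forms (Suc k)"
    for x vs
    using forms_high_degree_zero[OF mixed_difference_forms[OF k ext_one_affine_translate[OF G that]]
      big]
    by (simp add: form_apply)
  from taylor_expansion[OF k x G this, of 1]
  show "G \<xi> = (\<Sum>s = 0..?N. power_pairing (Suc k) s (?c s) \<xi>)"
    by (simp add: power_pairing_linear atLeast0AtMost lessThan_Suc_atMost)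
qed

section \<open>Pairings with exterior powers are affine along decomposable directions\<close>

text \<open>
  In \<open>\<langle>c; (\<xi> + a \<and> \<beta>)\<^sup>s\<rangle>\<close> each occurrence of \<open>a \<and> \<beta>\<close> can be made to contract \<open>c\<close> with \<open>a\<close>, which
  gives zero.
\<close>

lemma power_pairing_invariant:
  assumes c: "c \<in> exterior_forms (Suc k * s)" and x: "\<xi> \<in> exterior_forms (Suc k)"
    and a: "a \<in> exterior_forms 1" and b: "\<beta> \<in> exterior_forms k" and ac: "interior_product a c = 0"
  shows "power_pairing (Suc k) s c (\<xi> + wedge 1 k a \<beta>) = power_pairing (Suc k) s c \<xi>"
  using c ac
proof (induction s arbitrary: c)
  case 0
  then show ?case by (simp add: power_pairing_0)
next
  case (Suc s)
  let ?p = "Suc k" and ?h = "wedge 1 k a \<beta>"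
  have h: "?h \<in> exterior_forms ?p" by (rule wedge_one_forms[OF a b])
  have c: "c \<in> exterior_forms (?p + ?p * s)" using Suc.prems by simp
  have "contract ?p c ?h = contract k (interior_product a c) \<beta>"
    by (rule contract_wedge_one[OF c a b])
  then have "contract ?p c (\<xi> + ?h) = contract ?p c \<xi>"
    using Suc.prems(2) by (simp add: contract_linear)
  moreover have "interior_product a (contract ?p c \<xi>) = 0"
  proof
    fix ws
    have "c (basis_list I @ form_vector a # ws) = 0" for I
      using forms_move_to_front[OF c, of "basis_list I" "form_vector a" ws]
        interior_product_zeroD[OF Suc.prems(2)] by simp
    then show "interior_product a (contract ?p c \<xi>) ws = 0 ws"
      by (simp add: interior_product_def contract_def form_apply)
  qed
  ultimately show ?case
    using Suc.IH[OF contract_forms[OF c]] power_pairing_Suc[OF Suc.prems(1)] x h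
    by (simp add: forms_add)
qed

text \<open>
  Splitting off one factor, the term with \<open>t a \<and> \<beta>\<close> in it pairs a form from which \<open>a\<close> has
  already been contracted; by invariance the remaining factors do not contribute any further
  power of \<open>t\<close>.
\<close>

lemma power_pairing_affine:
  assumes c: "c \<in> exterior_forms (Suc k * s)" and x: "\<xi> \<in> exterior_forms (Suc k)"
    and a: "a \<in> exterior_forms 1" and b: "\<beta> \<in> exterior_forms k"
  shows "\<exists>K. \<forall>t. power_pairing (Suc k) s c (\<xi> + t \<cdot> wedge 1 k a \<beta>) = power_pairing (Suc k) s c \<xi>
    + t * K"
  using c
proof (induction s arbitrary: c)
  case 0
  then show ?case by (simp add: power_pairing_0)
next
  case (Suc s)
  let ?p = "Suc k" and ?h = "wedge 1 k a \<beta>"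
  have h: "?h \<in> exterior_forms ?p" by (rule wedge_one_forms[OF a b])
  have c: "c \<in> exterior_forms (?p + ?p * s)" using Suc.prems by simp
  have ch: "contract ?p c ?h = contract k (interior_product a c) \<beta>"
    by (rule contract_wedge_one[OF c a b])
  have "interior_product a (contract ?p c ?h) = 0"
    unfolding ch by (auto simp: fun_eq_iff
      form_apply interior_product_def contract_def intro!: sum.neutral forms_repeated_front[OF c])
  then have inv: "power_pairing ?p s (contract ?p c ?h) (\<xi> + t \<cdot> ?h)
    = power_pairing ?p s (contract ?p c ?h) \<xi>" for t
    using power_pairing_invariant[OF contract_forms[OF c] x a forms_scale[OF b, of t]]
    by (simp add: wedge_linear)
  obtain K where K: "power_pairing ?p s (contract ?p c \<xi>) (\<xi> + t \<cdot> ?h)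
    = power_pairing ?p s (contract ?p c \<xi>) \<xi> + t * K" for t
    using Suc.IH[OF contract_forms[OF c]] by blast
  have "power_pairing ?p (Suc s) c (\<xi> + t \<cdot> ?h)
      = power_pairing ?p (Suc s) c \<xi> + t * (K + power_pairing ?p s (contract ?p c ?h) \<xi>)" for t
  proof -
    have xt: "\<xi> + t \<cdot> ?h \<in> exterior_forms ?p" using x h by blast
    show ?thesis
      unfolding power_pairing_Suc[OF Suc.prems xt] power_pairing_Suc[OF Suc.prems x]
      by (simp add: contract_linear power_pairing_linear K[simplified] inv[simplified] algebra_simps)
  qed
  then show ?case by blast
qed

section \<open>Ext-int. one affine functions\<close>

text \<open>
  Equality in the convexity inequality gives affinity on segments; a point outside the unit
  interval is reached from a segment on which 1 or 0 is an interior point.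
\<close>

lemma affine_if_convex_and_concave:
  fixes g :: "real \<Rightarrow> real"
  assumes "convex_on UNIV g" "convex_on UNIV (\<lambda>t. - g t)"
  shows "g t = g 0 + t * (g 1 - g 0)"
proof -
  have eq: "g ((1 - u) * x + u * y) = (1 - u) * g x + u * g y" if "0 \<le> u" "u \<le> 1" for u x y
    using convex_onD[OF assms(1) that, of x y] convex_onD[OF assms(2) that, of x y] by simp
  consider "0 \<le> t" "t \<le> 1" | "t > 1" | "t < 0" by linarith
  then show ?thesis
  proof cases
    case 1
    then show ?thesis using eq[of t 0 1] by (simp add: algebra_simps)
  next
    case 2
    then have "g 1 = (1 - 1 / t) * g 0 + (1 / t) * g t" using eq[of "1 / t" 0 t] by simp
    then show ?thesis using 2 by (simp add: field_simps)
  next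
    case 3
    \<comment> \<open>the weights that express 0 as a combination of \<open>t\<close> and 1\<close>
    define d where "d = 1 / (1 - t)"
    have d: "(1 - t) * d = 1" "0 \<le> d" "d \<le> 1" using 3 by (auto simp: d_def)
    have "g 0 = d * g t + (1 - d) * g 1"
      using eq[of "1 - d" t 1] d by (simp add: algebra_simps)
    then have "(1 - t) * g 0 = (1 - t) * (d * g t + (1 - d) * g 1)" by (rule arg_cong)
    also have "\<dots> = ((1 - t) * d) * g t + ((1 - t) - (1 - t) * d) * g 1"
      by (simp add: algebra_simps)
    finally show ?thesis unfolding d(1) by (simp add: algebra_simps)
  qed
qed

lemma convex_on_affine: "convex_on UNIV (\<lambda>t :: real. A + t * B)"
  by (intro convex_onI) (auto simp: algebra_simps)

lemma ext_int_one_affine_iff: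
  fixes f :: "('n::{finite,linorder}) form \<Rightarrow> 'n form \<Rightarrow> real"
  shows "ext_int_one_affine (Suc m) f \<longleftrightarrow>
    (\<forall>\<xi>\<in>exterior_forms (Suc (Suc m)). \<forall>\<eta>\<in>exterior_forms m. \<forall>a\<in>exterior_forms 1. \<forall>b\<in>exterior_forms
      (Suc m).
      \<exists>K. \<forall>t. f (\<xi> + t \<cdot> wedge 1 (Suc m) a b) (\<eta> + t \<cdot> interior_product a b) = f \<xi> \<eta> + t * K)"
    (is "?L \<longleftrightarrow> ?R")
proof -
  have eq: "(\<lambda>vs. \<xi> vs + t * \<omega> vs) = \<xi> + t \<cdot> \<omega>" for \<xi> \<omega> :: "'n form" and t
    by (simp add: fun_eq_iff form_apply)
  let ?g = "\<lambda>\<xi> \<eta> a b t. f (\<xi> + t \<cdot> wedge 1 (Suc m) a b) (\<eta> + t \<cdot> interior_product a b)"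
  have L: "?L \<longleftrightarrow> (\<forall>\<xi>\<in>exterior_forms (Suc (Suc m)). \<forall>\<eta>\<in>exterior_forms m. \<forall>a\<in>exterior_forms 1.
    \<forall>b\<in>exterior_forms (Suc m).
      convex_on UNIV (?g \<xi> \<eta> a b) \<and> convex_on UNIV (\<lambda>t. - ?g \<xi> \<eta> a b t))"
    unfolding ext_int_one_affine_def ext_int_one_convex_def eq by (simp add: ball_conj_distrib)
  have "convex_on UNIV g \<and> convex_on UNIV (\<lambda>t. - g t) \<longleftrightarrow> (\<exists>K. \<forall>t. g t = g 0 + t * K)"
    for g :: "real \<Rightarrow> real"
  proof
    assume "\<exists>K. \<forall>t. g t = g 0 + t * K"
    then obtain K where K: "g t = g 0 + t * K" for t by blast
    have "g = (\<lambda>t. g 0 + t * K)" by (intro ext K)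
    moreover have "- g t = - g 0 + t * (- K)" for t using K[of t] by simp
    then have "(\<lambda>t. - g t) = (\<lambda>t. - g 0 + t * (- K))" by (intro ext)
    ultimately show "convex_on UNIV g \<and> convex_on UNIV (\<lambda>t. - g t)" using convex_on_affine by metis
  qed (use affine_if_convex_and_concave in blast)
  then show ?thesis unfolding L by simp
qed

lemma invariant_sum:
  assumes "\<And>i. i \<in> A \<Longrightarrow> g i \<in> exterior_forms k"
    and "\<And>x i. x \<in> exterior_forms k \<Longrightarrow> i \<in> A \<Longrightarrow> \<Phi> (x + g i) = \<Phi> x"
    and "finite A" "x \<in> exterior_forms k"
  shows "\<Phi> (x + (\<Sum>i\<in>A. g i)) = \<Phi> x"
  using assms(3,1,2,4)
proof (induction A arbitrary: x rule: finite_induct)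
  case (insert i A)
  have "\<Phi> (x + (\<Sum>i\<in>insert i A. g i)) = \<Phi> ((x + g i) + (\<Sum>i\<in>A. g i))"
    using insert.hyps by (simp add: add.assoc)
  also have "\<dots> = \<Phi> (x + g i)" using insert.prems by (intro insert.IH) auto
  finally show ?case using insert.prems by simp
qed simp

text \<open>
  The mixed difference of \<open>F\<close> in a basis direction of the first and one of the second variable
  vanishes: since the degrees add up to more than \<open>n\<close>, the two basis forms share an index \<open>i\<close>,
  and \<open>F\<close> is affine on the space of directions \<open>(e\<^sup>i \<and> \<beta>, e\<^sup>i \<and> \<gamma>)\<close>. Summing over the basis
  forms in each variable removes all interaction.
\<close>

lemma separation:
  fixes F :: "'n::{finite,linorder} form \<Rightarrow> 'n form \<Rightarrow> real"
  assumes line: "\<And>\<xi> \<zeta> a \<beta> \<gamma>. \<xi> \<in> exterior_forms (Suc k) \<Longrightarrow> \<zeta> \<in> exterior_forms (Suc l) \<Longrightarrow>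
      a \<in> exterior_forms 1 \<Longrightarrow> \<beta> \<in> exterior_forms k \<Longrightarrow> \<gamma> \<in> exterior_forms l \<Longrightarrow>
      \<exists>K. \<forall>t. F (\<xi> + t \<cdot> wedge 1 k a \<beta>) (\<zeta> + t \<cdot> wedge 1 l a \<gamma>) = F \<xi> \<zeta> + t * K"
    and large: "CARD('n) < Suc k + Suc l"
    and x: "\<xi> \<in> exterior_forms (Suc k)" and z: "\<zeta> \<in> exterior_forms (Suc l)"
  shows "F \<xi> \<zeta> = F \<xi> 0 + F 0 \<zeta> - F 0 0"
proof -
  let ?E = "\<lambda>I :: 'n list. decomposable (basis_list I)"
  have sq: "F (\<xi> + wedge 1 k a \<beta>) (\<zeta> + wedge 1 l a \<gamma>) - F (\<xi> + wedge 1 k a \<beta>) \<zeta> = F \<xi> (\<zeta>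
    + wedge 1 l a \<gamma>) - F \<xi> \<zeta>"
    if x: "\<xi> \<in> exterior_forms (Suc k)" and z: "\<zeta> \<in> exterior_forms (Suc l)" and a: "a \<in> exterior_forms 1"
      and b: "\<beta> \<in> exterior_forms k" and g: "\<gamma> \<in> exterior_forms l" for \<xi> \<zeta> a \<beta> \<gamma>
  proof -
    let ?u = "wedge 1 k a \<beta>" and ?v = "wedge 1 l a \<gamma>"
    obtain K1 where K1: "F (\<xi> + t \<cdot> ?u) \<zeta> = F \<xi> \<zeta> + t * K1" for t
      using line[OF x z a b forms_zero] by (auto simp: wedge_linear)
    obtain K2 where K2: "F \<xi> (\<zeta> + t \<cdot> ?v) = F \<xi> \<zeta> + t * K2" for t
      using line[OF x z a forms_zero g] by (auto simp: wedge_linear)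
    have x2: "\<xi> + 2 \<cdot> ?u \<in> exterior_forms (Suc k)" using x wedge_one_forms[OF a b] by blast
    obtain K3 where K3: "F (\<xi> + 2 \<cdot> ?u + t \<cdot> wedge 1 k a ((-2) \<cdot> \<beta>)) (\<zeta> + t \<cdot> wedge 1 l a (2 \<cdot> \<gamma>))
      = F (\<xi> + 2 \<cdot> ?u) \<zeta> + t * K3" for t
      using line[OF x2 z a forms_scale[OF b] forms_scale[OF g]] by blast
    have e: "\<xi> + 2 \<cdot> ?u + 1 \<cdot> wedge 1 k a ((-2) \<cdot> \<beta>) = \<xi>"
      "\<xi> + 2 \<cdot> ?u + (1/2) \<cdot> wedge 1 k a ((-2) \<cdot> \<beta>) = \<xi> + ?u"
      "\<zeta> + 1 \<cdot> wedge 1 l a (2 \<cdot> \<gamma>) = \<zeta> + 2 \<cdot> ?v"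
      "\<zeta> + (1/2) \<cdot> wedge 1 l a (2 \<cdot> \<gamma>) = \<zeta> + ?v"
      unfolding wedge_linear by (simp_all add: fun_eq_iff form_apply)
    have "F (\<xi> + ?u) (\<zeta> + ?v) = F (\<xi> + 2 \<cdot> ?u) \<zeta> + 1/2 * K3"
      "F \<xi> (\<zeta> + 2 \<cdot> ?v) = F (\<xi> + 2 \<cdot> ?u) \<zeta> + 1 * K3"
      using K3[of "1/2"] K3[of 1] unfolding e by auto
    moreover have "F (\<xi> + ?u) \<zeta> = F \<xi> \<zeta> + K1" "F (\<xi> + 2 \<cdot> ?u) \<zeta> = F \<xi> \<zeta> + 2 * K1"
      "F \<xi> (\<zeta> + ?v) = F \<xi> \<zeta> + K2" "F \<xi> (\<zeta> + 2 \<cdot> ?v) = F \<xi> \<zeta> + 2 * K2"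
      using K1[of 1] K1[of 2] K2[of 1] K2[of 2] by auto
    ultimately show ?thesis by simp
  qed
  have basis: "F (\<xi> + r \<cdot> ?E I) (\<zeta> + s \<cdot> ?E J) - F (\<xi> + r \<cdot> ?E I) \<zeta> = F \<xi> (\<zeta> + s \<cdot> ?E J) - F \<xi> \<zeta>"
    if I: "I \<in> increasing_indices (Suc k)" and J: "J \<in> increasing_indices (Suc l)"
      and x: "\<xi> \<in> exterior_forms (Suc k)" and z: "\<zeta> \<in> exterior_forms (Suc l)" for I J r s \<xi> \<zeta>
  proof -
    have "set I \<inter> set J \<noteq> {}"
    proof
      assume "set I \<inter> set J = {}"
      then have "card (set I \<union> set J) = Suc k + Suc l"
        using I J by (simp add: card_Un_disjoint distinct_card increasing_distinct increasing_length)
      then show False using card_mono[of "UNIV :: 'n set" "set I \<union> set J"] large by simp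
    qed
    then obtain i where i: "i \<in> set I" "i \<in> set J" by blast
    let ?a = "one_form (axis i 1)"
    have "axis i 1 \<in> set (basis_list I)" "axis i 1 \<in> set (basis_list J)"
      using i by (auto simp: basis_list_def)
    then obtain \<beta> \<gamma> where b: "\<beta> \<in> exterior_forms k" "?E I = wedge 1 k ?a \<beta>"
      and g: "\<gamma> \<in> exterior_forms l" "?E J = wedge 1 l ?a \<gamma>"
      using I J by (metis basis_list_simps(4) decomposable_divisible diff_Suc_1 increasing_length)
    have "r \<cdot> ?E I = wedge 1 k ?a (r \<cdot> \<beta>)" "s \<cdot> ?E J = wedge 1 l ?a (s \<cdot> \<gamma>)"
      using b g by (simp_all add: wedge_linear)
    then show ?thesis using sq[OF x z one_form_forms forms_scale[OF b(1)] forms_scale[OF g(1)]] by simp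
  qed
  have E: "r \<cdot> ?E I \<in> exterior_forms p" if "I \<in> increasing_indices p" for I r p
    using that by (intro forms_scale decomposable_forms') (simp add: increasing_length)
  have "F \<xi> (\<zeta> + s \<cdot> ?E J) - F \<xi> \<zeta> = F 0 (\<zeta> + s \<cdot> ?E J) - F 0 \<zeta>"
    if J: "J \<in> increasing_indices (Suc l)" and z: "\<zeta> \<in> exterior_forms (Suc l)" for J \<zeta> s
    using invariant_sum[of "increasing_indices (Suc k)" "\<lambda>I. \<xi> (basis_list I) \<cdot> ?E I" "Suc k"
        "\<lambda>\<xi>. F \<xi> (\<zeta> + s \<cdot> ?E J) - F \<xi> \<zeta>" 0] basis[OF _ J _ z] E
    by (simp flip: form_expansion[OF x])
  then have "F \<xi> (0 + (\<Sum>J\<in>increasing_indices (Suc l). \<zeta> (basis_list J) \<cdot> ?E J)) - F 0 (0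
    + (\<Sum>J\<in>increasing_indices (Suc l). \<zeta> (basis_list J) \<cdot> ?E J)) = F \<xi> 0 - F 0 0"
    by (intro invariant_sum[of _ _ "Suc l" "\<lambda>\<zeta>. F \<xi> \<zeta> - F 0 \<zeta>"])
      (auto simp: E algebra_simps)
  then show ?thesis by (simp flip: form_expansion[OF z])
qed

theorem theorem1:
  fixes f :: "('n::{finite,linorder}) form \<Rightarrow> 'n form \<Rightarrow> real"
    and n k :: nat
  assumes n_def: "n = CARD('n)"
    and "1 \<le> k" and "k \<le> n - 1"
  shows "ext_int_one_affine k f \<longleftrightarrow>
    (\<exists>c d :: nat \<Rightarrow> 'n form.
       (\<forall>s \<le> n div (k + 1). c s \<in> exterior_forms ((k + 1) * s)) \<and>
       (\<forall>r \<le> n div (n - k + 1). d r \<in> exterior_forms ((n - k + 1) * r)) \<and>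
       (\<forall>\<xi>\<in>exterior_forms (k + 1). \<forall>\<eta>\<in>exterior_forms (k - 1).
          f \<xi> \<eta> =
            (\<Sum>s = 0..n div (k + 1).
               form_inner ((k + 1) * s) (c s) (wedge_power (k + 1) \<xi> s)) +
            (\<Sum>r = 0..n div (n - k + 1).
               form_inner ((n - k + 1) * r) (d r)
                 (wedge_power (n - k + 1) (hodge_star (k - 1) \<eta>) r))))"
proof -
  obtain m where k: "k = Suc m" using \<open>1 \<le> k\<close> by (cases k) auto
  define l where "l = n - k"
  have n: "n = Suc m + l" and l: "1 \<le> l" using assms by (auto simp: k l_def)
  have card: "CARD('n) = Suc m + l" using n_def n by simp
  have ks: "k + 1 = Suc k" "n - k + 1 = Suc l" "k - 1 = m" by (simp_all add: k n)
  define R where "R c d \<longleftrightarrow>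
       (\<forall>s \<le> n div Suc k. c s \<in> exterior_forms (Suc k * s)) \<and>
       (\<forall>r \<le> n div Suc l. d r \<in> exterior_forms (Suc l * r)) \<and>
       (\<forall>\<xi>\<in>exterior_forms (Suc k). \<forall>\<eta>\<in>exterior_forms m.
          f \<xi> \<eta> = (\<Sum>s = 0..n div Suc k. power_pairing (Suc k) s (c s) \<xi>) +
            (\<Sum>r = 0..n div Suc l. power_pairing (Suc l) r (d r) (hodge_star m \<eta>)))"
    for c d :: "nat \<Rightarrow> 'n form"
  have "ext_int_one_affine k f \<longleftrightarrow> (\<exists>c d. R c d)"
  proof
    assume f: "ext_int_one_affine k f"
    have fl: "\<exists>K. \<forall>t. f (\<xi> + t \<cdot> wedge 1 k a \<beta>) (\<eta> + t \<cdot> interior_product a \<gamma>) = f \<xi> \<eta> + t * K"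
      if fl: "\<xi> \<in> exterior_forms (Suc k)" "\<eta> \<in> exterior_forms m" "a \<in> exterior_forms 1"
        "\<beta> \<in> exterior_forms k" "\<gamma> \<in> exterior_forms k" for \<xi> \<eta> a \<beta> \<gamma>
    proof -
      obtain b where "b \<in> exterior_forms k" "wedge 1 k a b = wedge 1 k a \<beta>"
        "interior_product a b = interior_product a \<gamma>"
        using decoupling[OF fl(3), of \<beta> m \<gamma>] fl k by blast
      then show ?thesis
        using f fl unfolding k ext_int_one_affine_iff by metis
    qed
    \<comment> \<open>With this sign, \<open>\<epsilon> \<star>\<close> inverts the star on \<open>(k - 1)\<close>-forms; so \<open>F\<close> is \<open>f\<close> in the variables \<open>\<xi>\<close>
      and \<open>\<star>\<eta>\<close>.\<close>
    define \<epsilon> :: real where "\<epsilon> = (-1) ^ (m * Suc l)"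
    define F where "F \<xi> \<zeta> = f \<xi> (\<epsilon> \<cdot> hodge_star (Suc l) \<zeta>)" for \<xi> \<zeta>
    have line: "\<exists>K. \<forall>t. F (\<xi> + t \<cdot> wedge 1 k a \<beta>) (\<zeta> + t \<cdot> wedge 1 l a \<gamma>) = F \<xi> \<zeta> + t * K"
      if x: "\<xi> \<in> exterior_forms (Suc k)" and z: "\<zeta> \<in> exterior_forms (Suc l)"
        and a: "a \<in> exterior_forms 1"
        and b: "\<beta> \<in> exterior_forms k" and g: "\<gamma> \<in> exterior_forms l" for \<xi> \<zeta> a \<beta> \<gamma>
    proof -
      let ?g = "(\<epsilon> * (-1) ^ l) \<cdot> hodge_star l \<gamma>"
      have hz: "\<epsilon> \<cdot> hodge_star (Suc l) \<zeta> \<in> exterior_forms m"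
        using hodge_star_forms[of "Suc l" \<zeta>] card by (auto intro!: forms_scale)
      have hg: "?g \<in> exterior_forms k"
        using hodge_star_forms[of l \<gamma>] card k by (auto intro!: forms_scale)
      have "\<epsilon> \<cdot> hodge_star (Suc l) (\<zeta> + t \<cdot> wedge 1 l a \<gamma>)
          = \<epsilon> \<cdot> hodge_star (Suc l) \<zeta> + t \<cdot> interior_product a ?g" for t
        unfolding hodge_star_linear interior_product_linear
        using hodge_star_wedge_one[OF a g] card by (simp add: fun_eq_iff form_apply algebra_simps)
      then show ?thesis unfolding F_def using fl[OF x hz a b hg] by simp
    qed
    have "ext_one_affine k (\<lambda>\<xi>. F \<xi> 0)"
      unfolding ext_one_affine_def
    proof (intro ballI allI)
      fix \<xi> a \<beta> :: "'n form" and t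
      assume "\<xi> \<in> exterior_forms (Suc k)" "a \<in> exterior_forms 1" "\<beta> \<in> exterior_forms k"
      then obtain K where "\<And>t. F (\<xi> + t \<cdot> wedge 1 k a \<beta>) 0 = F \<xi> 0 + t * K"
        using line[of \<xi> 0 a \<beta> 0] by (auto simp: wedge_linear)
      from this[of t] this[of 1] 
      show "F (\<xi> + t \<cdot> wedge 1 k a \<beta>) 0 = F \<xi> 0 + t * (F (\<xi> + wedge 1 k a \<beta>) 0 - F \<xi> 0)"
        by simp
    qed
    then obtain c where c: "\<And>s. c s \<in> exterior_forms (Suc k * s)"
      "\<And>\<xi>. \<xi> \<in> exterior_forms (Suc k) \<Longrightarrow> F \<xi> 0 = (\<Sum>s = 0..n div Suc k. power_pairing (Suc k) s (c s) \<xi>)"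
      using ext_one_affine_representation[OF \<open>1 \<le> k\<close>] unfolding n_def by blast
    \<comment> \<open>The constant term is counted with \<open>c\<close>.\<close>
    have "ext_one_affine l (\<lambda>\<zeta>. F 0 \<zeta> - F 0 0)"
      unfolding ext_one_affine_def
    proof (intro ballI allI)
      fix \<zeta> a \<gamma> :: "'n form" and t
      assume "\<zeta> \<in> exterior_forms (Suc l)" "a \<in> exterior_forms 1" "\<gamma> \<in> exterior_forms l"
      then obtain K where "\<And>t. F 0 (\<zeta> + t \<cdot> wedge 1 l a \<gamma>) = F 0 \<zeta> + t * K"
        using line[of 0 \<zeta> a 0 \<gamma>] by (auto simp: wedge_linear)
      from this[of t] this[of 1] 
      show "F 0 (\<zeta> + t \<cdot> wedge 1 l a \<gamma>) - F 0 0 = F 0 \<zeta> - F 0 0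
          + t * (F 0 (\<zeta> + wedge 1 l a \<gamma>) - F 0 0 - (F 0 \<zeta> - F 0 0))"
        by simp
    qed
    then obtain d where d: "\<And>r. d r \<in> exterior_forms (Suc l * r)"
      "\<And>\<zeta>. \<zeta> \<in> exterior_forms (Suc l) \<Longrightarrow> F 0 \<zeta> - F 0 0 = (\<Sum>r
        = 0..n div Suc l. power_pairing (Suc l) r (d r) \<zeta>)"
      using ext_one_affine_representation[OF l] unfolding n_def by blast
    have "f \<xi> \<eta> = (\<Sum>s = 0..n div Suc k. power_pairing (Suc k) s (c s) \<xi>) +
            (\<Sum>r = 0..n div Suc l. power_pairing (Suc l) r (d r) (hodge_star m \<eta>))"
      if x: "\<xi> \<in> exterior_forms (Suc k)" and e: "\<eta> \<in> exterior_forms m" for \<xi> \<eta>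
    proof -
      have h: "hodge_star m \<eta> \<in> exterior_forms (Suc l)"
        using hodge_star_forms[of m \<eta>] card by simp
      have "\<epsilon> \<cdot> hodge_star (Suc l) (hodge_star m \<eta>) = \<eta>"
        using hodge_star_hodge_star[OF e] card by (simp add: \<epsilon>_def flip: power_mult_distrib)
      then have "f \<xi> \<eta> = F \<xi> (hodge_star m \<eta>)" by (simp add: F_def)
      also have "\<dots> = F \<xi> 0 + F 0 (hodge_star m \<eta>) - F 0 0"
        by (rule separation[OF line _ x h]) (use card k in auto)
      finally show ?thesis using c(2)[OF x] d(2)[OF h] by simp
    qed
    then show "\<exists>c d. R c d" using c(1) d(1) unfolding R_def by blast
  next
    assume "\<exists>c d. R c d"
    then obtain c d where R: "R c d" by blast
    show "ext_int_one_affine k f"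
      unfolding k ext_int_one_affine_iff unfolding k[symmetric]
    proof (intro ballI)
      fix \<xi> \<eta> a b :: "'n form"
      assume x: "\<xi> \<in> exterior_forms (Suc k)" and e: "\<eta> \<in> exterior_forms m"
        and a: "a \<in> exterior_forms 1" and b: "b \<in> exterior_forms k"
      let ?w = "wedge 1 k a b" and ?i = "interior_product a b"
      define g where "g = (-1) ^ m \<cdot> hodge_star k b"
      have g: "g \<in> exterior_forms l" using hodge_star_forms[of k b] card k by (auto simp: g_def)
      have h: "hodge_star m \<eta> \<in> exterior_forms (Suc l)"
        using hodge_star_forms[of m \<eta>] card by simp
      have hi: "hodge_star m (\<eta> + t \<cdot> ?i) = hodge_star m \<eta> + t \<cdot> wedge 1 l a g" for t
        using hodge_star_interior_product[OF a, of b m] b card k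
        by (simp add: hodge_star_linear g_def wedge_linear)
      have xt: "\<xi> + t \<cdot> ?w \<in> exterior_forms (Suc k)" for t
        using x wedge_one_forms[OF a b] by blast
      have et: "\<eta> + t \<cdot> ?i \<in> exterior_forms m" for t
        using e interior_product_forms[of b m a] b k by blast
      have "\<forall>s\<in>{0..n div Suc k}. \<exists>K. \<forall>t. power_pairing (Suc k) s (c s) (\<xi> + t \<cdot> ?w)
        = power_pairing (Suc k) s (c s) \<xi> + t * K"
        using R power_pairing_affine[OF _ x a b] by (auto simp: R_def)
      then obtain K where K: "\<And>s t. s \<in> {0..n div Suc k} \<Longrightarrow> power_pairing (Suc k) s (c s) (\<xi>
        + t \<cdot> ?w) = power_pairing (Suc k) s (c s) \<xi> + t * K s"
        by metis
      have "\<forall>r\<in>{0..n div Suc l}. \<exists>K. \<forall>t. power_pairing (Suc l) r (d r) (hodge_star m \<eta>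
        + t \<cdot> wedge 1 l a g) = power_pairing (Suc l) r (d r) (hodge_star m \<eta>) + t * K"
        using R power_pairing_affine[OF _ h a g] by (auto simp: R_def)
      then obtain K' where K': "\<And>r t. r \<in> {0..n div Suc l}
        \<Longrightarrow> power_pairing (Suc l) r (d r) (hodge_star m \<eta> + t \<cdot> wedge 1 l a g) = power_pairing (Suc l)
          r (d r) (hodge_star m \<eta>) + t * K' r"
        by metis
      have f: "f \<xi> \<eta> = (\<Sum>s = 0..n div Suc k. power_pairing (Suc k) s (c s) \<xi>) +
            (\<Sum>r = 0..n div Suc l. power_pairing (Suc l) r (d r) (hodge_star m \<eta>))"
        if "\<xi> \<in> exterior_forms (Suc k)" "\<eta> \<in> exterior_forms m" for \<xi> \<eta>
        using R that by (auto simp: R_def)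
      have "f (\<xi> + t \<cdot> ?w) (\<eta> + t \<cdot> ?i) = f \<xi> \<eta> + t * ((\<Sum>s = 0..n div Suc k. K s) + (\<Sum>r
        = 0..n div Suc l. K' r))" for t
        unfolding f[OF xt et] f[OF x e] hi
        by (simp add: K K' sum.distrib sum_distrib_left distrib_left del: One_nat_def)
      then show "\<exists>K. \<forall>t. f (\<xi> + t \<cdot> ?w) (\<eta> + t \<cdot> ?i) = f \<xi> \<eta> + t * K" by blast
    qed
  qed
  then show ?thesis unfolding ks R_def power_pairing_def .
qed

end
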